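(* For $n\ge 1$ and integers $w\ge 0$, $s_1,\ldots,s_n\ge 0$ and $r_1,\ldots,r_n>0$, the sum $S_w\begin{pmatrix}s_1,\ldots,s_n\\ r_1,\ldots,r_n\end{pmatrix}$ can be written as a $\mathbb{Q}$-linear combination of multiple zeta values of weight $w$ and depth $\le n$.
   Context: An index is a tuple of positive integers; its depth is its length, its weight $\mathrm{wt}$ is the sum of its entries; a non-empty index is admissible if its last entry is $\ge 2$ (the empty index is admissible). For an admissible index $(k_1,\dots,k_d)$ the multiple zeta value is $\zeta(k_1,\dots,k_d)=\sum_{0<m_1<\cdots<m_d}m_1^{-k_1}\cdots m_d^{-k_d}$; its weight and depth are those of the index. For integers $w,s_1,\ldots,s_n\ge 0$ and $r_1,\ldots,r_n>0$ define $$S_w\begin{pmatrix}s_1,\ldots,s_n\\ r_1,\ldots,r_n\end{pmatrix}:=\sum \zeta\begin{pmatrix}\boldsymbol{l}_1,\ldots,\boldsymbol{l}_n\\ \boldsymbol{k}_1,\ldots,\boldsymbol{k}_n\end{pmatrix},$$ the sum being over all indices $\boldsymbol{l}_i$ of depth $s_i$ and all admissible indices $\boldsymbol{k}_i$ of depth $r_i$ ($1\le i\le n$) with $\sum_i\mathrm{wt}(\boldsymbol{k}_i)+\sum_i\mathrm{wt}(\boldsymbol{l}_i)=w$ (an empty sum is $0$). Here, for $\boldsymbol{l}_i=(l_{i,1},\ldots,l_{i,s_i})$ and $\boldsymbol{k}_i=(k_{i,1},\ldots,k_{i,r_i})$, $$\zeta\begin{pmatrix}\boldsymbol{l}_1,\ldots,\boldsymbol{l}_n\\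 \boldsymbol{k}_1,\ldots,\boldsymbol{k}_n\end{pmatrix}:=\sum\prod_{i=1}^n\frac{1}{a_{i,1}^{k_{i,1}}\cdots a_{i,r_i}^{k_{i,r_i}}\,b_{i,1}^{l_{i,1}}\cdots b_{i,s_i}^{l_{i,s_i}}},$$ summed over all positive integers with $0<b_{i,1}\le\cdots\le b_{i,s_i+1}$, $0<a_{i,1}<\cdots<a_{i,r_i}$, $b_{i,s_i+1}=a_{i,r_i}$ for $i=1,\ldots,n$, and $b_{i+1,1}<a_{i,1}$ for $i=1,\ldots,n-1$ (so the $b_{i,s_i+1}$ are not extra free variables; the definition makes sense also when some $s_i=0$). *)

theory Defs
  imports "HOL-Analysis.Analysis"
begin

definition is_index :: "nat list \<Rightarrow> bool" where
  "is_index k \<longleftrightarrow> (\<forall>x\<in>set k. 0 < x)"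

abbreviation (input) depth :: "nat list \<Rightarrow> nat" where
  "depth k \<equiv> length k"

abbreviation (input) weight :: "nat list \<Rightarrow> nat" where
  "weight k \<equiv> sum_list k"

definition admissible :: "nat list \<Rightarrow> bool" where
  "admissible k \<longleftrightarrow> is_index k \<and> (k \<noteq> [] \<longrightarrow> 2 \<le> last k)"

definition mzv :: "nat list \<Rightarrow> real" where
  "mzv k = (\<Sum>\<^sub>\<infinity>m\<in>{m. length m = depth k \<and> (\<forall>x\<in>set m. 0 < x) \<and> sorted_wrt (<) m}.
     (\<Prod>j<depth k. 1 / real (m ! j) ^ (k ! j)))"

text \<open>
  Lists are indexed from \<open>0\<close>, so \<open>a ! i ! j\<close> is \<open>a\<^sub>i\<^sub>+\<^sub>1\<^sub>,\<^sub>j\<^sub>+\<^sub>1\<close>. Row \<open>b ! i\<close> has one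
  entry more than row \<open>ls ! i\<close>: its last entry is forced to equal the last entry of \<open>a ! i\<close>,
  hence it is not a free summation variable, and it does not occur in the summand.
  If \<open>ls ! i\<close> is empty, that entry is also the first one of \<open>b ! i\<close>.
\<close>

definition zeta_domain :: "nat list list \<Rightarrow> nat list list \<Rightarrow> (nat list list \<times> nat list list) set" where
  "zeta_domain ls ks = {(a, b).
     length a = length ks \<and> length b = length ks \<and>
     (\<forall>i<length ks.
        length (a ! i) = depth (ks ! i) \<and> length (b ! i) = depth (ls ! i) + 1 \<and>
        (\<forall>x\<in>set (a ! i). 0 < x) \<and> (\<forall>x\<in>set (b ! i). 0 < x) \<and>
        sorted_wrt (<) (a ! i) \<and> sorted_wrt (\<le>) (b ! i) \<and>
        last (b ! i) = last (a ! i)) \<and>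
     (\<forall>i. i + 1 < length ks \<longrightarrow> hd (b ! (i + 1)) < hd (a ! i))}"

definition zeta2 :: "nat list list \<Rightarrow> nat list list \<Rightarrow> real" where
  "zeta2 ls ks = (\<Sum>\<^sub>\<infinity>(a, b)\<in>zeta_domain ls ks.
     (\<Prod>i<length ks.
        1 / ((\<Prod>j<depth (ks ! i). real (a ! i ! j) ^ (ks ! i ! j)) *
             (\<Prod>j<depth (ls ! i). real (b ! i ! j) ^ (ls ! i ! j)))))"

definition index_arrays :: "nat \<Rightarrow> nat list \<Rightarrow> nat list \<Rightarrow> (nat list list \<times> nat list list) set" where
  "index_arrays w s r = {(ls, ks).
     length ls = length r \<and> length ks = length r \<and>
     (\<forall>i<length r. is_index (ls ! i) \<and> depth (ls ! i) = s ! i \<and>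
                   admissible (ks ! i) \<and> depth (ks ! i) = r ! i) \<and>
     (\<Sum>i<length r. weight (ks ! i)) + (\<Sum>i<length r. weight (ls ! i)) = w}"

definition S_sum :: "nat \<Rightarrow> nat list \<Rightarrow> nat list \<Rightarrow> real" where
  "S_sum w s r = (\<Sum>(ls, ks)\<in>index_arrays w s r. zeta2 ls ks)"

text \<open>The sum defining \<^const>\<open>S_sum\<close> really is finite, so \<^const>\<open>sum\<close> does not default to \<open>0\<close>.\<close>

lemma finite_index_arrays: "finite (index_arrays w s r)"
proof -
  define A where "A = {k :: nat list. set k \<subseteq> {..w} \<and> length k \<le> w}"
  define B where "B = {ls. set ls \<subseteq> A \<and> length ls = length r}"
  have "finite A" unfolding A_def by (rule finite_lists_length_le) simp
  then have "finite B" unfolding B_def by (rule finite_lists_length_eq)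
  have small: "k \<in> A" if "is_index k" "weight k \<le> w" for k
  proof -
    have "length k \<le> weight k"
      using that(1) by (induction k) (auto simp: is_index_def)
    moreover have "x \<le> weight k" if "x \<in> set k" for x
      using that by (intro member_le_sum_list) auto
    ultimately show ?thesis using that(2) by (force simp: A_def)
  qed
  have row: "weight (ls ! i) \<le> (\<Sum>i<length r. weight (ls ! i))" if "i < length r" for ls i
    using that by (intro member_le_sum) auto
  have "index_arrays w s r \<subseteq> B \<times> B"
  proof safe
    fix ls ks assume *: "(ls, ks) \<in> index_arrays w s r"
    have "ls ! i \<in> A \<and> ks ! i \<in> A" if "i < length r" for i
      using * that row[of i ls] row[of i ks]
      by (auto simp: index_arrays_def admissible_def intro!: small)
    then show "ls \<in> B" "ks \<in> B"
      using * by (auto simp: B_def index_arrays_def in_set_conv_nth)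
  qed
  then show ?thesis using \<open>finite B\<close> by (meson finite_SigmaI finite_subset)
qed

end

theory Submission
  imports Defs "HOL-Computational_Algebra.Formal_Power_Series"
begin

text \<open>
  Work with power series in a variable \<open>x\<close> marking the weight and with all summation variables
  bounded by \<open>N\<close>. Then \<open>S\<^sub>w\<close> is a coefficient of a sum over the zigzag
  \<open>b\<^sub>1\<^sub>,\<^sub>1 \<le> \<dots> \<le> M\<^sub>1 > \<dots> > a\<^sub>1\<^sub>,\<^sub>1 > b\<^sub>2\<^sub>,\<^sub>1 \<le> \<dots>\<close> in which every entry \<open>b\<close> or
  \<open>a\<close> carries the factor \<open>x / (b - x)\<close> and every peak \<open>M\<^sub>i = a\<^sub>i\<^sub>,\<^sub>r\<close> the factor
  \<open>x\<^sup>2 / (M\<^sub>i (M\<^sub>i - x))\<close>. Removing one of the inequalities \<open>b\<^sub>i\<^sub>+\<^sub>1\<^sub>,\<^sub>1 < a\<^sub>i\<^sub>,\<^sub>1\<close> expresses a product of two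
  shorter zigzags as a sum of two zigzags, and this reduces the claim to
  \<open>s\<^sub>2 = \<dots> = s\<^sub>n = 0\<close>, because products of multiple zeta values are sums of such values by
  the stuffle product.

  In that case sum over \<open>s\<^sub>1\<close> with weight \<open>y\<close> and over \<open>r\<^sub>i - 1\<close> with weight \<open>z\<^sub>i\<close>. With
  \<open>\<beta> = x (1 + y)\<close> and \<open>\<alpha>\<^sub>i = x (1 - z\<^sub>i)\<close> the result, for \<open>N\<close> tending to infinity, is \<open>x\<close> to the power \<open>2 n\<close> times
  \<open>F(\<alpha>\<^sub>1,\<dots>,\<alpha>\<^sub>n; \<beta>)\<close>, the sum over \<open>M\<^sub>n < \<dots> < M\<^sub>1\<close> of the product of all \<open>1 / M\<^sub>i\<close>, of the
  factors \<open>a - \<alpha>\<^sub>i\<close> for \<open>M\<^sub>i\<^sub>+\<^sub>1 < a < M\<^sub>i\<close>, and of the factors \<open>1 / (a - \<beta>)\<close> for \<open>a \<le> M\<^sub>1\<close>.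
  Telescoping over \<open>M\<^sub>1\<close> shows that \<open>F(\<alpha>\<^sub>1,\<dots>,\<alpha>\<^sub>n; \<beta>) - F(\<alpha>\<^sub>1,\<dots>,\<alpha>\<^sub>n; \<beta> - 1)\<close> equals
  \<open>F(\<alpha>\<^sub>2,\<dots>,\<alpha>\<^sub>n; \<beta> - 1) / ((1 - \<beta>) (1 - \<beta> + \<alpha>\<^sub>1))\<close>. Hence \<open>F\<close> is the sum of
  \<open>\<Prod>\<^sub>i 1 / ((m\<^sub>i - \<beta>) (m\<^sub>i - \<beta> + \<alpha>\<^sub>i))\<close> over \<open>m\<^sub>1 < \<dots> < m\<^sub>n\<close>. For rational \<open>y\<close> and \<open>z\<^sub>i\<close> its
  coefficients in \<open>x\<close> are rational combinations of multiple zeta values with \<open>n\<close> entries, all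
  at least \<open>2\<close>, and interpolation in \<open>y\<close> and the \<open>z\<^sub>i\<close> isolates the individual terms.
\<close>

section \<open>Rational spans of multiple zeta values\<close>

lemma infsum_eq_lim_exhaustion:
  fixes f :: "'b \<Rightarrow> real"
  assumes nonneg: "\<And>x. x \<in> A \<Longrightarrow> 0 \<le> f x"
    and fin: "\<And>N. finite (X N)" and sub: "\<And>N. X N \<subseteq> A" and mono: "mono X"
    and ex: "A \<subseteq> (\<Union>N. X N)"
    and lim: "(\<lambda>N. sum f (X N)) \<longlonglongrightarrow> L"
  shows "infsum f A = L"
proof -
  have X_mono: "X M \<subseteq> X N" if "M \<le> N" for M N
    using mono that by (auto dest: monoD)
  have inc: "incseq (\<lambda>N. sum f (X N))"
  proof (rule incseq_SucI)
    show "sum f (X N) \<le> sum f (X (Suc N))" for N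
    proof (rule sum_mono2[of "X (Suc N)" "X N" f])
      show "0 \<le> f b" if "b \<in> X (Suc N) - X N" for b
        using that sub[of "Suc N"] by (intro nonneg) blast
    qed (simp_all add: fin X_mono)
  qed
  have le: "sum f (X N) \<le> L" for N
    using incseq_le[OF inc lim] .
  \<comment> \<open>\<open>infsum\<close> is \<open>0\<close> by default on families that are not
    summable, so summability has to be derived: each finite subset of \<open>A\<close> lies in one
    \<open>X N\<close>, hence \<open>L\<close> bounds all finite sums.\<close>
  have cover: "\<exists>N. F \<subseteq> X N" if "finite F" "F \<subseteq> A" for F
    using that
  proof (induction F)
    case (insert x F)
    then obtain N where N: "F \<subseteq> X N" by auto
    obtain M where M: "x \<in> X M" using insert.prems ex by blast
    have "x \<in> X (max M N)" using M X_mono[of M "max M N"] by (meson max.cobounded1 subsetD)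
    moreover have "F \<subseteq> X (max M N)" using N X_mono[of N "max M N"] by (meson max.cobounded2 order_trans)
    ultimately show ?case by blast
  qed simp
  have bound: "sum f F \<le> L" if "finite F" "F \<subseteq> A" for F
  proof -
    have "\<exists>N. F \<subseteq> X N" using that by (rule cover)
    then obtain N where N: "F \<subseteq> X N" ..
    have "sum f F \<le> sum f (X N)"
    proof (rule sum_mono2[of "X N" F f])
      show "0 \<le> f b" if "b \<in> X N - F" for b
        using that sub[of N] by (intro nonneg) blast
    qed (simp_all add: fin N)
    then show ?thesis using le[of N] by linarith
  qed
  have summ: "f summable_on A"
  proof (rule nonneg_bdd_above_summable_on)
    show "bdd_above (sum f ` {F. F \<subseteq> A \<and> finite F})"
      by (rule bdd_aboveI2[of _ _ L]) (simp add: bound)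
  qed (rule nonneg)
  have "infsum f A \<le> L"
    by (rule infsum_le_finite_sums[OF summ]) (rule bound)
  moreover have "sum f (X N) \<le> infsum f A" for N
  proof (rule finite_sum_le_infsum[OF summ, of "X N"])
    show "0 \<le> f x" if "x \<in> A - X N" for x using that by (intro nonneg) blast
  qed (simp_all add: fin sub)
  then have "L \<le> infsum f A"
    by (intro LIMSEQ_le_const2[OF lim]) simp
  ultimately show ?thesis by simp
qed

text \<open>Peeling off the smallest variable makes the lower bound \<open>a\<close> an argument. On
  \<open>recip_powers k\<close> with \<open>a = 0\<close> this is the series of \<open>mzv k\<close>
  restricted to variables at most \<open>N\<close>.\<close>

fun chain :: "(nat \<Rightarrow> 'a::comm_ring_1) list \<Rightarrow> nat \<Rightarrow> nat \<Rightarrow> 'a" where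
  "chain [] a N = 1"
| "chain (f # fs) a N = (\<Sum>m\<in>{a<..N}. f m * chain fs m N)"

abbreviation recip_powers :: "nat list \<Rightarrow> (nat \<Rightarrow> real) list" where
  "recip_powers \<equiv> map (\<lambda>k m. 1 / real m ^ k)"

lemma chain_nonneg:
  fixes fs :: "(nat \<Rightarrow> 'a::linordered_idom) list"
  assumes "\<And>f m. f \<in> set fs \<Longrightarrow> a < m \<Longrightarrow> 0 \<le> f m"
  shows "0 \<le> chain fs a N"
  using assms
proof (induction fs arbitrary: a)
  case (Cons f fs)
  show ?case unfolding chain.simps
    by (intro sum_nonneg mult_nonneg_nonneg Cons.IH) (use Cons.prems in auto)
qed auto

lemma chain_mono:
  fixes fs :: "(nat \<Rightarrow> 'a::linordered_idom) list"
  assumes "\<And>f m. f \<in> set fs \<Longrightarrow> a < m \<Longrightarrow> 0 \<le> f m" and "N \<le> N'"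
  shows "chain fs a N \<le> chain fs a N'"
  using assms
proof (induction fs arbitrary: a)
  case (Cons f fs)
  have "chain (f # fs) a N \<le> (\<Sum>m\<in>{a<..N}. f m * chain fs m N')"
    unfolding chain.simps
    by (intro sum_mono mult_left_mono Cons.IH) (use Cons.prems in auto)
  also have "\<dots> \<le> chain (f # fs) a N'"
    unfolding chain.simps
    by (intro sum_mono2 mult_nonneg_nonneg chain_nonneg) (use Cons.prems in auto)
  finally show ?case .
qed auto

lemma chain_bounded:
  fixes fs :: "(nat \<Rightarrow> 'a::linordered_idom) list"
  assumes "\<And>f m. f \<in> set fs \<Longrightarrow> a < m \<Longrightarrow> 0 \<le> f m"
    and "\<And>f b N. f \<in> set fs \<Longrightarrow> a \<le> b \<Longrightarrow> (\<Sum>m\<in>{b<..N}. f m) \<le> C" and "0 \<le> C"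
  shows "chain fs a N \<le> C ^ length fs"
  using assms
proof (induction fs arbitrary: a)
  case (Cons f fs)
  have "chain (f # fs) a N \<le> (\<Sum>m\<in>{a<..N}. f m * C ^ length fs)"
    unfolding chain.simps
    by (intro sum_mono mult_left_mono Cons.IH) (use Cons.prems in auto)
  also have "\<dots> = (\<Sum>m\<in>{a<..N}. f m) * C ^ length fs"
    by (simp add: sum_distrib_right)
  also have "\<dots> \<le> C * C ^ length fs"
    by (intro mult_right_mono) (use Cons.prems in auto)
  finally show ?case by simp
qed auto

lemma chain_convergent:
  fixes fs :: "(nat \<Rightarrow> real) list"
  assumes "\<And>f m. f \<in> set fs \<Longrightarrow> a < m \<Longrightarrow> 0 \<le> f m"
    and "\<And>f b N. f \<in> set fs \<Longrightarrow> a \<le> b \<Longrightarrow> (\<Sum>m\<in>{b<..N}. f m) \<le> C" and "0 \<le> C"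
  shows "convergent (chain fs a)"
proof -
  have "Bseq (chain fs a)"
    by (rule BseqI'[of _ "C ^ length fs"])
      (use chain_nonneg[of fs a] chain_bounded[of fs a C] assms in auto)
  moreover have "incseq (chain fs a)"
    by (rule incseq_SucI, rule chain_mono) (use assms in auto)
  ultimately show ?thesis by (simp add: Bseq_monoseq_convergent monoseq_Suc incseq_Suc_iff)
qed

lemma sum_recip_squares_le:
  "(\<Sum>m\<in>{a<..N}. 1 / (real m)\<^sup>2) \<le> 2"
proof -
  \<comment> \<open>Keeping the term \<open>1 / real (Suc n)\<close> makes the induction go through,
    by comparison with the telescoping sum of 1 / (n (n + 1)).\<close>
  have *: "(\<Sum>m\<in>{0<..Suc n}. 1 / (real m)\<^sup>2) \<le> 2 - 1 / real (Suc n)" for n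
  proof (induction n)
    case 0
    have "{0<..Suc 0} = {1}" by auto
    then show ?case by simp
  next
    case (Suc n)
    have "{0<..Suc (Suc n)} = insert (Suc (Suc n)) {0<..Suc n}" by auto
    then have "(\<Sum>m\<in>{0<..Suc (Suc n)}. 1 / (real m)\<^sup>2) =
        1 / (real (Suc (Suc n)))\<^sup>2 + (\<Sum>m\<in>{0<..Suc n}. 1 / (real m)\<^sup>2)"
      by simp
    also have "\<dots> \<le> 1 / (real (Suc n) * real (Suc (Suc n))) + (2 - 1 / real (Suc n))"
      by (intro add_mono Suc divide_left_mono) (auto simp: power2_eq_square)
    also have "\<dots> = 2 - 1 / real (Suc (Suc n))"
      by (simp add: divide_simps) (simp add: algebra_simps)
    finally show ?case .
  qed
  have "(\<Sum>m\<in>{a<..N}. 1 / (real m)\<^sup>2) \<le> (\<Sum>m\<in>{0<..Suc N}. 1 / (real m)\<^sup>2)"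
    by (rule sum_mono2) auto
  also have "\<dots> \<le> 2 - 1 / real (Suc N)" by (rule *)
  also have "\<dots> \<le> 2" by simp
  finally show ?thesis .
qed

text \<open>Entries at least \<open>2\<close> bound every one-variable sum by \<open>2\<close>, so
  the truncated nested sums increase to a finite limit.\<close>

lemma mzv_chain_limit:
  assumes "\<forall>x\<in>set k. 2 \<le> x"
  shows "(\<lambda>N. chain (recip_powers k) 0 N) \<longlonglongrightarrow> mzv k"
proof -
  define X where "X k a N = {m. length m = length k \<and> (\<forall>x\<in>set m. a < x \<and> x \<le> N) \<and> sorted_wrt (<) m}"
    for k :: "nat list" and a N :: nat
  define g where "g k m = (\<Prod>j<length k. 1 / real (m ! j) ^ (k ! j))" for k m :: "nat list"
  have fin: "finite (X k a N)" for k a N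
  proof (rule finite_subset)
    show "X k a N \<subseteq> {m. set m \<subseteq> {..N} \<and> length m = length k}" by (auto simp: X_def)
  qed (simp add: finite_lists_length_eq)
  have sum_X: "sum (g k) (X k a N) = chain (recip_powers k) a N" for k a N
  proof (induction k arbitrary: a)
    case Nil
    have "X [] a N = {[]}" by (auto simp: X_def)
    then show ?case by (simp add: g_def)
  next
    case (Cons k0 k)
    have g_Cons: "g (k0 # k) (b # m) = 1 / real b ^ k0 * g k m" for b m
      unfolding g_def by (subst prod.lessThan_Suc_shift length_Cons)+ simp
    have "sum (g (k0 # k)) (X (k0 # k) a N) = (\<Sum>(b, m)\<in>Sigma {a<..N} (\<lambda>b. X k b N). 1 / real b ^ k0 * g k m)"
      by (rule sum.reindex_bij_witness[of _ "\<lambda>(b, m). b # m" "\<lambda>m. (hd m, tl m)"])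
        (force simp: X_def length_Suc_conv g_Cons)+
    also have "\<dots> = (\<Sum>b\<in>{a<..N}. \<Sum>m\<in>X k b N. 1 / real b ^ k0 * g k m)"
      by (rule sum.Sigma[symmetric]) (auto simp: fin)
    also have "\<dots> = chain (recip_powers (k0 # k)) a N"
      by (simp add: Cons.IH[symmetric] sum_distrib_left)
    finally show ?case .
  qed
  have "convergent (chain (recip_powers k) 0)"
  proof (rule chain_convergent[of _ _ 2])
    fix f b N assume "f \<in> set (recip_powers k)"
    then obtain e where e: "f = (\<lambda>m. 1 / real m ^ e)" "2 \<le> e" using assms by auto
    have "(\<Sum>m\<in>{b<..N}. f m) \<le> (\<Sum>m\<in>{b<..N}. 1 / (real m)\<^sup>2)"
      unfolding e by (intro sum_mono divide_left_mono power_increasing) (use e in auto)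
    also have "\<dots> \<le> 2" by (rule sum_recip_squares_le)
    finally show "(\<Sum>m\<in>{b<..N}. f m) \<le> 2" .
  qed auto
  then obtain L where L: "chain (recip_powers k) 0 \<longlonglongrightarrow> L" by (auto simp: convergent_def)
  have "infsum (g k) {m. length m = length k \<and> (\<forall>x\<in>set m. 0 < x) \<and> sorted_wrt (<) m} = L"
  proof (rule infsum_eq_lim_exhaustion[where X = "X k 0"])
    show "(\<lambda>N. sum (g k) (X k 0 N)) \<longlonglongrightarrow> L" using L by (simp add: sum_X)
    show "mono (X k 0)" by (auto simp: mono_def X_def)
    show "{m. length m = length k \<and> (\<forall>x\<in>set m. 0 < x) \<and> sorted_wrt (<) m} \<subseteq> (\<Union>N. X k 0 N)"
    proof
      fix m :: "nat list"
      assume m: "m \<in> {m. length m = length k \<and> (\<forall>x\<in>set m. 0 < x) \<and> sorted_wrt (<) m}"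
      then have "m \<in> X k 0 (sum_list m)"
        by (auto simp: X_def intro: member_le_sum_list)
      then show "m \<in> (\<Union>N. X k 0 N)" by blast
    qed
  qed (use fin in \<open>auto simp: X_def g_def intro!: prod_nonneg\<close>)
  then have "mzv k = L" by (simp add: mzv_def g_def[abs_def])
  then show ?thesis using L by simp
qed

section \<open>Rational combinations of values whose entries are all at least 2\<close>

definition big_indices :: "nat \<Rightarrow> nat \<Rightarrow> nat list set" where
  "big_indices n w = {k. length k \<le> n \<and> (\<forall>x\<in>set k. 2 \<le> x) \<and> sum_list k = w}"

text \<open>Entries at least \<open>2\<close> are stronger than admissibility, but this family is
  closed under the stuffle product and contains all that the closed form produces. Lengths below
  \<open>n\<close> are included because stuffling merges entries.\<close>

definition mzv_span :: "nat \<Rightarrow> nat \<Rightarrow> real set" where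
  "mzv_span n w = {v. \<exists>c :: nat list \<Rightarrow> rat. v = (\<Sum>k\<in>big_indices n w. of_rat (c k) * mzv k)}"

lemma finite_big_indices [simp]: "finite (big_indices n w)"
proof (rule finite_subset)
  show "big_indices n w \<subseteq> {k. set k \<subseteq> {..w} \<and> length k \<le> n}"
    by (auto simp: big_indices_def intro: member_le_sum_list)
qed (simp add: finite_lists_length_le)

lemma mzv_span_add: "u \<in> mzv_span n w \<Longrightarrow> v \<in> mzv_span n w \<Longrightarrow> u + v \<in> mzv_span n w"
proof -
  assume "u \<in> mzv_span n w" "v \<in> mzv_span n w"
  then obtain c d :: "nat list \<Rightarrow> rat" where
    "u = (\<Sum>k\<in>big_indices n w. of_rat (c k) * mzv k)" "v = (\<Sum>k\<in>big_indices n w. of_rat (d k) * mzv k)"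
    by (auto simp: mzv_span_def)
  then show ?thesis unfolding mzv_span_def
    by (auto intro!: exI[of _ "\<lambda>k. c k + d k"] simp: of_rat_add algebra_simps sum.distrib)
qed

lemma mzv_span_scale: "u \<in> mzv_span n w \<Longrightarrow> of_rat q * u \<in> mzv_span n w"
proof -
  assume "u \<in> mzv_span n w"
  then obtain c :: "nat list \<Rightarrow> rat" where
    "u = (\<Sum>k\<in>big_indices n w. of_rat (c k) * mzv k)"
    by (auto simp: mzv_span_def)
  then show ?thesis unfolding mzv_span_def
    by (auto intro!: exI[of _ "\<lambda>k. q * c k"] simp: of_rat_mult mult.assoc sum_distrib_left)
qed

lemma mzv_span_0: "0 \<in> mzv_span n w"
  unfolding mzv_span_def by (auto intro!: exI[of _ "\<lambda>_. 0"])

lemma mzv_span_sum: "(\<And>i. i \<in> I \<Longrightarrow> f i \<in> mzv_span n w) \<Longrightarrow> sum f I \<in> mzv_span n w"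
  by (induction I rule: infinite_finite_induct) (auto simp: mzv_span_0 mzv_span_add)

lemma mzv_in_span: "k \<in> big_indices n w \<Longrightarrow> mzv k \<in> mzv_span n w"
  unfolding mzv_span_def
  by (auto intro!: exI[of _ "\<lambda>j. if j = k then 1 else 0"] simp: if_distrib[where f = "\<lambda>q. real_of_rat q * _"] cong: if_cong)

section \<open>The stuffle product\<close>

fun stuffle :: "nat list \<Rightarrow> nat list \<Rightarrow> nat list list" where
  "stuffle [] l = [l]"
| "stuffle (k # ks) [] = [k # ks]"
| "stuffle (k # ks) (l # ls) =
     map ((#) k) (stuffle ks (l # ls)) @ map ((#) l) (stuffle (k # ks) ls) @
     map ((#) (k + l)) (stuffle ks ls)"

text \<open>Merging two entries adds them, which keeps the weight, shortens the index and leaves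
  entries at least \<open>2\<close>.\<close>

lemma set_stuffle:
  "m \<in> set (stuffle k l) \<Longrightarrow> \<forall>x\<in>set k. 2 \<le> x \<Longrightarrow> \<forall>x\<in>set l. 2 \<le> x \<Longrightarrow>
     length m \<le> length k + length l \<and> sum_list m = sum_list k + sum_list l \<and> (\<forall>x\<in>set m. 2 \<le> x)"
proof (induction k l arbitrary: m rule: stuffle.induct)
  case (3 k ks l ls)
  from "3.prems"(1) consider m' where "m = k # m'" "m' \<in> set (stuffle ks (l # ls))"
    | m' where "m = l # m'" "m' \<in> set (stuffle (k # ks) ls)"
    | m' where "m = (k + l) # m'" "m' \<in> set (stuffle ks ls)"
    by auto
  then show ?case
  proof cases
    case 1
    then show ?thesis using "3.IH"(1)[of m'] "3.prems" by simp
  next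
    case 2
    then show ?thesis using "3.IH"(2)[of m'] "3.prems" by simp
  next
    case 3
    then show ?thesis using "3.IH"(3)[of m'] "3.prems" by simp
  qed
qed auto

text \<open>Pairs split into \<open>m < l\<close>, \<open>m > l\<close> and \<open>m = l\<close>;
  these are the three branches of \<open>stuffle\<close>. All sums share the upper bound
  \<open>N\<close>, so the product rule is exact before any limit is taken.\<close>

lemma sum_times_sum_split:
  fixes f g :: "nat \<Rightarrow> 'a::comm_ring_1"
  shows "(\<Sum>m\<in>{a<..N}. f m) * (\<Sum>m\<in>{a<..N}. g m) =
    (\<Sum>m\<in>{a<..N}. f m * (\<Sum>l\<in>{m<..N}. g l)) + (\<Sum>m\<in>{a<..N}. g m * (\<Sum>l\<in>{m<..N}. f l)) +
    (\<Sum>m\<in>{a<..N}. f m * g m)"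
proof (induction "N - a" arbitrary: a)
  case (Suc d)
  then have "{a<..N} = insert (Suc a) {Suc a<..N}" "d = N - Suc a" by auto
  with Suc(1)[of "Suc a"] show ?case by (simp add: algebra_simps)
qed simp

lemma chain_stuffle:
  "chain (recip_powers k) a N * chain (recip_powers l) a N =
     (\<Sum>m\<leftarrow>stuffle k l. chain (recip_powers m) a N)"
proof (induction k l arbitrary: a rule: stuffle.induct)
  case (3 k ks l ls)
  have sum_Cons: "(\<Sum>m\<leftarrow>map ((#) j) ms. chain (recip_powers m) a N) =
      (\<Sum>i\<in>{a<..N}. 1 / real i ^ j * (\<Sum>m\<leftarrow>ms. chain (recip_powers m) i N))" for j ms
    by (induction ms) (auto simp: sum.distrib algebra_simps add_divide_distrib)
  show ?case unfolding stuffle.simps map_append sum_list_append sum_Cons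
    unfolding 3[symmetric] list.map chain.simps sum_times_sum_split
    by (simp add: algebra_simps power_add)
qed auto

lemma mzv_mult_in_span:
  assumes "k \<in> big_indices n u" "l \<in> big_indices m v"
  shows "mzv k * mzv l \<in> mzv_span (n + m) (u + v)"
proof -
  have kl: "\<forall>x\<in>set k. 2 \<le> x" "\<forall>x\<in>set l. 2 \<le> x"
    using assms by (auto simp: big_indices_def)
  have big: "\<forall>x\<in>set j. 2 \<le> x" if "j \<in> set (stuffle k l)" for j
    using set_stuffle[OF that kl] by (elim conjE)
  have "(\<lambda>N. chain (recip_powers k) 0 N * chain (recip_powers l) 0 N) \<longlonglongrightarrow> mzv k * mzv l"
    by (intro tendsto_mult mzv_chain_limit) (use assms in \<open>auto simp: big_indices_def\<close>)
  moreover have "(\<lambda>N. \<Sum>j\<leftarrow>js. chain (recip_powers j) 0 N) \<longlonglongrightarrow> (\<Sum>j\<leftarrow>js. mzv j)"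
    if "set js \<subseteq> set (stuffle k l)" for js
    using that
  proof (induction js)
    case (Cons j js)
    then have "(\<lambda>N. chain (recip_powers j) 0 N) \<longlonglongrightarrow> mzv j"
      by (intro mzv_chain_limit big) simp
    with Cons show ?case by (simp add: tendsto_add)
  qed simp
  then have "(\<lambda>N. \<Sum>j\<leftarrow>stuffle k l. chain (recip_powers j) 0 N) \<longlonglongrightarrow> (\<Sum>j\<leftarrow>stuffle k l. mzv j)"
    by simp
  ultimately have eq: "mzv k * mzv l = (\<Sum>j\<leftarrow>stuffle k l. mzv j)"
    unfolding chain_stuffle by (rule LIMSEQ_unique)
  have "(\<Sum>j\<leftarrow>js. mzv j) \<in> mzv_span (n + m) (u + v)"
    if "set js \<subseteq> set (stuffle k l)" for js
    using that
  proof (induction js)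
    case (Cons j js)
    then have "j \<in> set (stuffle k l)" by simp
    then have "length j \<le> length k + length l \<and> sum_list j = sum_list k + sum_list l \<and> (\<forall>x\<in>set j. 2 \<le> x)"
      using kl by (rule set_stuffle)
    then have "j \<in> big_indices (n + m) (u + v)"
      using assms unfolding big_indices_def mem_Collect_eq by linarith
    then have "mzv j \<in> mzv_span (n + m) (u + v)" by (rule mzv_in_span)
    with Cons show ?case by (simp add: mzv_span_add)
  qed (auto simp: mzv_span_0)
  then show ?thesis by (simp add: eq)
qed

lemma mzv_span_mult:
  assumes "x \<in> mzv_span n u" "y \<in> mzv_span m v"
  shows "x * y \<in> mzv_span (n + m) (u + v)"
proof -
  obtain c d :: "nat list \<Rightarrow> rat" where
    x: "x = (\<Sum>k\<in>big_indices n u. of_rat (c k) * mzv k)" and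
    y: "y = (\<Sum>k\<in>big_indices m v. of_rat (d k) * mzv k)"
    using assms by (auto simp: mzv_span_def)
  have "x * y = (\<Sum>k\<in>big_indices n u. \<Sum>l\<in>big_indices m v. of_rat (c k * d l) * (mzv k * mzv l))"
    unfolding x y sum_product by (simp add: of_rat_mult mult_ac)
  also have "\<dots> \<in> mzv_span (n + m) (u + v)"
    by (intro mzv_span_sum mzv_span_scale mzv_mult_in_span)
  finally show ?thesis .
qed

section \<open>Sequences with limit in the span, and interpolation\<close>

definition lim_span :: "nat \<Rightarrow> nat \<Rightarrow> (nat \<Rightarrow> real) set" where
  "lim_span n w = {u. \<exists>v\<in>mzv_span n w. u \<longlonglongrightarrow> v}"

lemma lim_span_add: "u \<in> lim_span n w \<Longrightarrow> v \<in> lim_span n w \<Longrightarrow> (\<lambda>N. u N + v N) \<in> lim_span n w"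
  by (auto simp: lim_span_def intro!: tendsto_add bexI[OF _ mzv_span_add])

lemma lim_span_scale: "u \<in> lim_span n w \<Longrightarrow> (\<lambda>N. of_rat q * u N) \<in> lim_span n w"
  by (auto simp: lim_span_def intro!: tendsto_mult_left bexI[OF _ mzv_span_scale])

lemma lim_span_diff:
  "u \<in> lim_span n w \<Longrightarrow> v \<in> lim_span n w \<Longrightarrow> (\<lambda>N. u N - v N) \<in> lim_span n w"
  using lim_span_add[of u n w "\<lambda>N. of_rat (- 1) * v N"] lim_span_scale[of v n w "- 1"]
  by (simp add: of_rat_minus)

lemma lim_span_sum:
  "(\<And>i. i \<in> I \<Longrightarrow> f i \<in> lim_span n w) \<Longrightarrow> (\<lambda>N. \<Sum>i\<in>I. f i N) \<in> lim_span n w"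
proof (induction I rule: infinite_finite_induct)
  case (insert x F)
  then show ?case by (auto intro: lim_span_add)
qed (auto simp: lim_span_def mzv_span_0)

lemma lim_span_mult:
  "f \<in> lim_span n u \<Longrightarrow> g \<in> lim_span m v \<Longrightarrow> (\<lambda>N. f N * g N) \<in> lim_span (n + m) (u + v)"
  by (auto simp: lim_span_def intro!: tendsto_mult bexI[OF _ mzv_span_mult])

text \<open>Subtracting \<open>2 ^ Suc B\<close> times the value at \<open>t / 2\<close> cancels the leading term, so no
  Vandermonde determinant is needed.\<close>

lemma poly_coeffs_in_lim_span:
  assumes "\<And>t :: rat. 0 \<le> t \<Longrightarrow> t \<le> 1 \<Longrightarrow> (\<lambda>N. \<Sum>j\<le>B. of_rat t ^ j * c j N) \<in> lim_span n w"
    and "j \<le> B"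
  shows "c j \<in> lim_span n w"
  using assms
proof (induction B arbitrary: c j)
  case 0
  then show ?case using "0.prems"(1)[of 0] by simp
next
  case (Suc B)
  \<comment> \<open>\<open>q j\<close> is the factor that coefficient \<open>j\<close> receives when
    the value at \<open>t / 2\<close>, times \<open>2 ^ Suc B\<close>, is subtracted from the value
    at \<open>t\<close>; it vanishes for \<open>j = Suc B\<close> and for no smaller
    \<open>j\<close>.\<close>
  define q where "q j = (1 - 2 ^ (Suc B - j) :: rat)" for j
  have q_eq: "real_of_rat (q j) = 1 - 2 ^ Suc B * (1 / 2) ^ j" if "j \<le> Suc B" for j
  proof -
    have "(2 :: real) ^ Suc B = 2 ^ (Suc B - j) * 2 ^ j"
      using that by (simp flip: power_add)
    then show ?thesis
      by (simp add: q_def of_rat_diff of_rat_power power_one_over del: power_Suc)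
  qed
  have low: "c j \<in> lim_span n w" if "j \<le> B" for j
  proof -
    have "(\<lambda>N. of_rat (q j) * c j N) \<in> lim_span n w"
    proof (rule Suc.IH[where c = "\<lambda>j N. of_rat (q j) * c j N"])
      fix t :: rat assume t: "0 \<le> t" "t \<le> 1"
      have "(\<lambda>N. (\<Sum>j\<le>Suc B. of_rat t ^ j * c j N) -
          of_rat (2 ^ Suc B) * (\<Sum>j\<le>Suc B. of_rat (t / 2) ^ j * c j N)) \<in> lim_span n w"
        by (intro lim_span_diff lim_span_scale Suc.prems) (use t in auto)
      also have "(\<lambda>N. (\<Sum>j\<le>Suc B. of_rat t ^ j * c j N) -
          of_rat (2 ^ Suc B) * (\<Sum>j\<le>Suc B. of_rat (t / 2) ^ j * c j N)) =
        (\<lambda>N. \<Sum>j\<le>Suc B. of_rat t ^ j * (of_rat (q j) * c j N))"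
        unfolding sum_distrib_left sum_subtractf[symmetric]
        by (intro ext sum.cong refl)
          (simp add: q_eq of_rat_divide of_rat_power power_divide algebra_simps power_one_over del: power_Suc)
      also have "\<dots> = (\<lambda>N. \<Sum>j\<le>B. of_rat t ^ j * (of_rat (q j) * c j N))"
        by (simp add: q_def)
      finally show "(\<lambda>N. \<Sum>j\<le>B. of_rat t ^ j * (of_rat (q j) * c j N)) \<in> lim_span n w" .
    qed (use that in auto)
    \<comment> \<open>Dividing by the nonzero rational \<open>q j\<close> recovers the coefficient.
      Its convergence is part of the conclusion, since \<open>lim_span\<close> contains only
      convergent sequences.\<close>
    then have "(\<lambda>N. of_rat (inverse (q j)) * (of_rat (q j) * c j N)) \<in> lim_span n w"
      by (rule lim_span_scale)
    moreover have "q j \<noteq> 0"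
    proof -
      have "(1 :: rat) < 2 ^ (Suc B - j)" using that by (intro one_less_power) auto
      then show ?thesis by (simp add: q_def)
    qed
    ultimately show ?thesis by (simp add: of_rat_inverse flip: mult.assoc)
  qed
  have "(\<lambda>N. (\<Sum>j\<le>Suc B. of_rat 1 ^ j * c j N) - (\<Sum>j\<le>B. c j N)) \<in> lim_span n w"
    by (intro lim_span_diff lim_span_sum Suc.prems low) auto
  then have "c (Suc B) \<in> lim_span n w" by simp
  with low Suc.prems(2) show ?case by (cases "j = Suc B") auto
qed

definition exps :: "nat \<Rightarrow> nat \<Rightarrow> nat list set" where
  "exps B n = {e. length e = n \<and> set e \<subseteq> {..B}}"

fun monomial :: "'a::comm_ring_1 list \<Rightarrow> nat list \<Rightarrow> 'a" where
  "monomial (z # zs) (p # ps) = z ^ p * monomial zs ps"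
| "monomial _ _ = 1"

lemma finite_exps [simp]: "finite (exps B n)"
  by (rule finite_subset[OF _ finite_lists_length_eq[of "{..B}" n]]) (auto simp: exps_def)

lemma exps_0 [simp]: "exps B 0 = {[]}"
  by (auto simp: exps_def)

lemma sum_exps_Suc:
  "(\<Sum>e\<in>exps B (Suc n). f e) = (\<Sum>p\<le>B. \<Sum>e\<in>exps B n. f (p # e))"
proof -
  have "(\<Sum>e\<in>exps B (Suc n). f e) = (\<Sum>(p, e)\<in>{..B} \<times> exps B n. f (p # e))"
    by (rule sum.reindex_bij_witness[of _ "\<lambda>(p, e). p # e" "\<lambda>e. (hd e, tl e)"])
      (auto simp: exps_def length_Suc_conv)
  then show ?thesis by (simp add: sum.cartesian_product)
qed

text \<open>With the other variables frozen at rational values, the sum is a univariate polynomial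
  in the first one; its coefficients are again polynomials in the remaining variables, so induction
  on \<open>d\<close> applies.\<close>

lemma multi_poly_coeffs_in_lim_span:
  assumes "\<And>ts :: rat list. length ts = d \<Longrightarrow> set ts \<subseteq> {0..1} \<Longrightarrow>
      (\<lambda>N. \<Sum>e\<in>exps B d. monomial (map of_rat ts) e * c e N) \<in> lim_span n w"
    and "e \<in> exps B d"
  shows "c e \<in> lim_span n w"
  using assms
proof (induction d arbitrary: c e)
  case 0
  then show ?case using "0.prems"(1)[of "[]"] by simp
next
  case (Suc d)
  obtain p e' where e: "e = p # e'" "p \<le> B" "e' \<in> exps B d"
    using Suc.prems(2) by (auto simp: exps_def length_Suc_conv)
  have "c (p # e') \<in> lim_span n w"
  proof (rule Suc.IH[where c = "\<lambda>e. c (p # e)"])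
    fix ts :: "rat list" assume ts: "length ts = d" "set ts \<subseteq> {0..1}"
    show "(\<lambda>N. \<Sum>e\<in>exps B d. monomial (map of_rat ts) e * c (p # e) N) \<in> lim_span n w"
    proof (rule poly_coeffs_in_lim_span[where c = "\<lambda>p N. \<Sum>e\<in>exps B d. monomial (map of_rat ts) e * c (p # e) N"])
      fix t :: rat assume "0 \<le> t" "t \<le> 1"
      then show "(\<lambda>N. \<Sum>j\<le>B. of_rat t ^ j * (\<Sum>e\<in>exps B d. monomial (map of_rat ts) e * c (j # e) N)) \<in> lim_span n w"
        using Suc.prems(1)[of "t # ts"] ts
        by (simp add: sum_exps_Suc sum_distrib_left mult.assoc)
    qed (use e in auto)
  qed (use e in auto)
  then show ?case by (simp add: e)
qed

section \<open>The generating function in closed form\<close>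

text \<open>This is the part of \<open>F\<close> with the largest variable M_1 =
  \<open>Suc i\<close> fixed, without 1 / M_1 and without the factors in \<beta>. In the last clause
  M_1 is \<open>Suc (Suc i)\<close>, and the integer \<open>Suc i\<close> either lies strictly
  between M_2 and M_1, with factor \<open>real (Suc i) - a\<close>, or is M_2.\<close>

fun numer :: "real list \<Rightarrow> nat \<Rightarrow> real" where
  "numer [] i = 0"
| "numer (a # as) 0 = (if as = [] then 1 else 0)"
| "numer (a # as) (Suc i) = (real (Suc i) - a) * numer (a # as) i + numer as i / real (Suc i)"

text \<open>The sum \<open>F\<close> truncated to M_1 at most \<open>N\<close>;
  \<open>pochhammer (1 - \<beta>) (Suc i)\<close> collects the factors a - \<beta> for a up to M_1 =
  \<open>Suc i\<close>. The value 1 for the empty list makes the shift relation hold for a single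
  parameter.\<close>

definition partial_gf :: "real list \<Rightarrow> real \<Rightarrow> nat \<Rightarrow> real" where
  "partial_gf as \<beta> N = (if as = [] then 1 else
     \<Sum>i<N. numer as i / (real (Suc i) * pochhammer (1 - \<beta>) (Suc i)))"

lemma partial_gf_Suc:
  "partial_gf as \<beta> (Suc N) = partial_gf as \<beta> N + numer as N / (real (Suc N) * pochhammer (1 - \<beta>) (Suc N))"
  by (simp add: partial_gf_def)

text \<open>Truncation at \<open>N\<close> adds one boundary term to the difference equation for
  \<open>F\<close>. In the induction on \<open>N\<close> both sides gain the same increment.\<close>

lemma partial_gf_shift:
  assumes "\<beta> < 1" "0 \<le> a"
  shows "partial_gf (a # as) \<beta> N = partial_gf (a # as) (\<beta> - 1) N +
    (partial_gf as (\<beta> - 1) N / (1 - \<beta>) - numer (a # as) N / pochhammer (1 - \<beta>) (Suc N)) / (1 - \<beta> + a)"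
proof (induction N)
  case 0
  then show ?case by (simp add: partial_gf_def)
next
  case (Suc N)
  define P where "P = pochhammer (1 - \<beta>) (Suc N)"
  define u where "u = 1 - \<beta>"
  define k where "k = real (Suc N)"
  have pos: "P > 0" "u > 0" "k > 0" "u + k > 0" "u + a > 0"
    using assms by (auto simp: P_def u_def k_def intro!: pochhammer_pos add_pos_pos)
  have P2: "pochhammer (1 - \<beta>) (Suc (Suc N)) = P * (u + k)"
    by (simp add: P_def u_def k_def pochhammer_rec' mult_ac add_ac)
  have P3: "pochhammer (1 - (\<beta> - 1)) (Suc N) = P * (u + k) / u"
    using P2 pos by (simp add: pochhammer_rec[of _ "Suc N"] u_def field_simps)
  define x y where "x = numer (a # as) N" and "y = numer as N"
  \<comment> \<open>The increments agree for arbitrary \<open>x\<close> and \<open>y\<close>, by an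
    identity of rational functions; the recursion of \<open>numer\<close> enters as
    \<open>(k - a) * x + y / k\<close>.\<close>
  have "x / (k * P) = x / (k * (P * (u + k) / u)) +
      (y / (k * (P * (u + k) / u)) / u - (((k - a) * x + y / k) / (P * (u + k)) - x / P)) / (u + a)"
    using pos by (simp add: divide_simps) algebra
  moreover have "partial_gf (a # as) \<beta> N = partial_gf (a # as) (\<beta> - 1) N + (partial_gf as (\<beta> - 1) N / u - x / P) / (u + a)"
    using Suc unfolding x_def P_def u_def .
  ultimately have "partial_gf (a # as) \<beta> N + x / (k * P) =
      partial_gf (a # as) (\<beta> - 1) N + x / (k * (P * (u + k) / u)) +
      ((partial_gf as (\<beta> - 1) N + y / (k * (P * (u + k) / u))) / u - ((k - a) * x + y / k) / (P * (u + k))) / (u + a)"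
    by (simp only: diff_divide_distrib add_divide_distrib)
  then show ?case
    unfolding partial_gf_Suc numer.simps P2 P3 P_def[symmetric] unfolding x_def y_def k_def u_def .
qed

text \<open>The step from \<beta> - (m - 1) to \<beta> - m turns the denominators 1 - \<beta> of the
  shift relation into m - \<beta>.\<close>

lemma partial_gf_telescope:
  assumes "\<beta> < 1" "0 \<le> a" "k \<le> K"
  shows "partial_gf (a # as) (\<beta> - real k) N = partial_gf (a # as) (\<beta> - real K) N +
    (\<Sum>m\<in>{k<..K}. 1 / ((real m - \<beta>) * (real m - \<beta> + a)) * partial_gf as (\<beta> - real m) N -
       numer (a # as) N / pochhammer (real m - \<beta>) (Suc N) / (real m - \<beta> + a))"
  using assms(3)
proof (induction K rule: dec_induct)
  case (step K)
  have "{k<..Suc K} = insert (Suc K) {k<..K}" using step.hyps by auto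
  then show ?case
    using step.IH partial_gf_shift[of "\<beta> - real K" a as N] assms
    by (simp add: algebra_simps diff_divide_distrib del: pochhammer_Suc)
qed simp

section \<open>Vanishing of the boundary terms\<close>

lemma numer_nonneg: "set as \<subseteq> {0..1} \<Longrightarrow> 0 \<le> numer as i"
  by (induction as i rule: numer.induct) auto

text \<open>Divided by \<open>fact i\<close>, the recursion adds at most C / m^2 at each step, with
  C the bound for the shorter list, and these increments are summable.\<close>

lemma numer_le_fact: "set as \<subseteq> {0..1} \<Longrightarrow> \<exists>C\<ge>0. \<forall>i. numer as i \<le> C * fact i"
proof (induction as)
  case Nil
  then show ?case by (auto intro: exI[of _ 0])
next
  case (Cons a as)
  then obtain C where C: "0 \<le> C" "\<And>i. numer as i \<le> C * fact i" by auto
  have "numer (a # as) i \<le> (1 + C * (\<Sum>m\<in>{0<..i}. 1 / (real m)\<^sup>2)) * fact i" for i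
  proof (induction i)
    case (Suc i)
    define s where "s = (\<Sum>m\<in>{0<..i}. 1 / (real m)\<^sup>2)"
    have "{0<..Suc i} = insert (Suc i) {0<..i}" by auto
    then have s: "(\<Sum>m\<in>{0<..Suc i}. 1 / (real m)\<^sup>2) = 1 / (real (Suc i))\<^sup>2 + s"
      by (simp add: s_def)
    have "numer (a # as) (Suc i) \<le> real (Suc i) * numer (a # as) i + numer as i / real (Suc i)"
      using Cons.prems numer_nonneg[OF Cons.prems, of i] by (auto intro!: mult_right_mono)
    also have "\<dots> \<le> real (Suc i) * ((1 + C * s) * fact i) + C * fact i / real (Suc i)"
      by (intro add_mono mult_left_mono divide_right_mono Suc.IH[folded s_def] C) auto
    also have "\<dots> = (1 + C * (1 / (real (Suc i))\<^sup>2 + s)) * fact (Suc i)"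
      by (simp add: fact_Suc divide_simps power2_eq_square) (simp add: algebra_simps)
    finally show ?case unfolding s .
  qed simp
  moreover have "(1 + C * (\<Sum>m\<in>{0<..i}. 1 / (real m)\<^sup>2)) * fact i \<le> (1 + C * 2) * fact i" for i
    by (intro mult_right_mono add_left_mono mult_left_mono sum_recip_squares_le) (use C in auto)
  ultimately have "numer (a # as) i \<le> (1 + C * 2) * fact i" for i
    by (meson order_trans)
  then show ?case using C by (intro exI[of _ "1 + C * 2"]) auto
qed

text \<open>\<open>Gamma_series\<close> tends to \<open>Gamma z\<close>, so the quotient decays like
  N to the power -z.\<close>

lemma fact_over_pochhammer_tendsto_0:
  assumes "z > (0 :: real)"
  shows "(\<lambda>N. fact N / pochhammer z (Suc N)) \<longlonglongrightarrow> 0"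
proof -
  have "(\<lambda>N. Gamma_series z N * exp (- z * ln (real N))) \<longlonglongrightarrow> Gamma z * 0"
  proof (intro tendsto_mult Gamma_series_LIMSEQ)
    show "(\<lambda>N. exp (- z * ln (real N))) \<longlonglongrightarrow> 0"
    proof (rule filterlim_compose[OF exp_at_bot])
      show "filterlim (\<lambda>N. - z * ln (real N)) at_bot sequentially"
        by (rule filterlim_tendsto_neg_mult_at_bot[OF tendsto_const])
          (use assms in \<open>auto intro: filterlim_compose[OF ln_at_top filterlim_real_sequentially]\<close>)
    qed
  qed
  moreover have "Gamma_series z N * exp (- z * ln (real N)) = fact N / pochhammer z (Suc N)" for N
    by (simp add: Gamma_series_def exp_minus field_simps)
  ultimately show ?thesis by simp
qed

lemma boundary_tendsto_0:
  assumes "set as \<subseteq> {0..1}" "z > 0"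
  shows "(\<lambda>N. numer as N / pochhammer z (Suc N)) \<longlonglongrightarrow> 0"
proof -
  obtain C where C: "0 \<le> C" "\<And>i. numer as i \<le> C * fact i"
    using numer_le_fact assms(1) by blast
  show ?thesis
  proof (rule tendsto_sandwich[where f = "\<lambda>_. 0"])
    show "(\<lambda>N. C * (fact N / pochhammer z (Suc N))) \<longlonglongrightarrow> 0"
      using tendsto_mult_left[OF fact_over_pochhammer_tendsto_0[OF assms(2)], of C] by simp
    show "\<forall>\<^sub>F N in sequentially. 0 \<le> numer as N / pochhammer z (Suc N)"
      by (intro always_eventually allI divide_nonneg_pos numer_nonneg assms pochhammer_pos)
    show "\<forall>\<^sub>F N in sequentially. numer as N / pochhammer z (Suc N) \<le> C * (fact N / pochhammer z (Suc N))"
      unfolding times_divide_eq_right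
      by (intro always_eventually allI divide_right_mono C less_imp_le pochhammer_pos assms)
  qed (rule tendsto_const)
qed

lemma partial_gf_nonneg:
  assumes "set as \<subseteq> {0..1}" "\<beta> < 1"
  shows "0 \<le> partial_gf as \<beta> N"
  unfolding partial_gf_def
  using assms by (auto intro!: sum_nonneg divide_nonneg_pos numer_nonneg mult_pos_pos pochhammer_pos simp del: pochhammer_Suc)

text \<open>For fixed \<open>N\<close> every denominator is at least \<open>K\<close>, so the
  remainder of the telescoped sum disappears as \<open>K\<close> grows.\<close>

lemma partial_gf_far_shift:
  assumes "set as \<subseteq> {0..1}" "\<beta> < 1" "as \<noteq> []"
  shows "(\<lambda>K. partial_gf as (\<beta> - real K) N) \<longlonglongrightarrow> 0"
proof -
  have "(\<lambda>K. \<Sum>i<N. numer as i / (real (Suc i) * pochhammer (1 - (\<beta> - real K)) (Suc i))) \<longlonglongrightarrow> (\<Sum>i<N. 0)"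
  proof (intro tendsto_sum)
    fix i
    have lower: "real K \<le> real (Suc i) * pochhammer (1 - (\<beta> - real K)) (Suc i)" for K
    proof -
      have "(1 :: real) \<le> (\<Prod>j<i. (1 - \<beta> + real K) + 1 + real j)"
        using assms by (intro prod_ge_1) auto
      then have "1 \<le> pochhammer ((1 - \<beta> + real K) + 1) i"
        by (simp add: pochhammer_prod lessThan_atLeast0 del: of_nat_Suc)
      then have "(1 - \<beta> + real K) * 1 \<le> pochhammer (1 - \<beta> + real K) (Suc i)"
        unfolding pochhammer_rec using assms by (intro mult_left_mono) auto
      then have "real K \<le> pochhammer (1 - (\<beta> - real K)) (Suc i)"
        using assms by (simp add: algebra_simps del: pochhammer_Suc)
      also have "\<dots> \<le> real (Suc i) * pochhammer (1 - (\<beta> - real K)) (Suc i)"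
        using assms pochhammer_pos[of "1 - (\<beta> - real K)" "Suc i"]
        by (simp del: pochhammer_Suc)
      finally show ?thesis .
    qed
    have "filterlim (\<lambda>K. real (Suc i) * pochhammer (1 - (\<beta> - real K)) (Suc i)) at_top sequentially"
      by (rule filterlim_at_top_mono[OF filterlim_real_sequentially]) (use lower in simp)
    then show "(\<lambda>K. numer as i / (real (Suc i) * pochhammer (1 - (\<beta> - real K)) (Suc i))) \<longlonglongrightarrow> 0"
      by (rule real_tendsto_divide_at_top[OF tendsto_const])
  qed
  then show ?thesis using assms(3) by (simp add: partial_gf_def)
qed

section \<open>The limit of the generating function as a nested sum of kernels\<close>

definition kernels :: "real \<Rightarrow> real list \<Rightarrow> (nat \<Rightarrow> real) list" where
  "kernels \<beta> = map (\<lambda>a m. 1 / ((real m - \<beta>) * (real m - \<beta> + a)))"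

lemma kernel_nonneg:
  assumes "f \<in> set (kernels \<beta> as)" "set as \<subseteq> {0..1}" "\<beta> < 1" "0 < m"
  shows "0 \<le> f m"
proof -
  have "real m \<ge> 1" using assms(4) by simp
  then show ?thesis using assms by (auto simp: kernels_def intro!: mult_nonneg_nonneg)
qed

text \<open>For m \<ge> 1 and \<beta> in [0, 1) one has m - \<beta> \<ge> (1 - \<beta>) m, so each
  factor is dominated by a multiple of 1 / m^2.\<close>

lemma kernel_chain_convergent:
  assumes "set as \<subseteq> {0..1}" "0 \<le> \<beta>" "\<beta> < 1"
  shows "convergent (chain (kernels \<beta> as) k)"
proof (rule chain_convergent[of _ _ "2 / (1 - \<beta>)\<^sup>2"])
  fix f b N assume f: "f \<in> set (kernels \<beta> as)"
  have "(\<Sum>m\<in>{b<..N}. f m) \<le> (\<Sum>m\<in>{b<..N}. 1 / (1 - \<beta>)\<^sup>2 * (1 / (real m)\<^sup>2))"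
  proof (rule sum_mono)
    fix m assume "m \<in> {b<..N}"
    then have m: "1 \<le> real m" by auto
    obtain a where "a \<in> set as" and f_eq: "f = (\<lambda>m. 1 / ((real m - \<beta>) * (real m - \<beta> + a)))"
      using f by (auto simp: kernels_def)
    then have a: "0 \<le> a" using assms(1) by auto
    have "\<beta> * 1 \<le> \<beta> * real m" using assms m by (intro mult_left_mono) auto
    then have le: "(1 - \<beta>) * real m \<le> real m - \<beta>" by (simp add: algebra_simps)
    have pos: "0 < (1 - \<beta>) * real m" using assms m by simp
    have "((1 - \<beta>) * real m) * ((1 - \<beta>) * real m) \<le> (real m - \<beta>) * (real m - \<beta> + a)"
      using le pos a by (intro mult_mono) auto
    then have "f m \<le> 1 / (((1 - \<beta>) * real m) * ((1 - \<beta>) * real m))"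
      unfolding f_eq by (intro frac_le[OF _ order_refl] mult_pos_pos pos) simp_all
    then show "f m \<le> 1 / (1 - \<beta>)\<^sup>2 * (1 / (real m)\<^sup>2)"
      by (simp add: power2_eq_square mult_ac)
  qed
  also have "\<dots> \<le> 1 / (1 - \<beta>)\<^sup>2 * 2"
    unfolding sum_distrib_left[symmetric] by (intro mult_left_mono sum_recip_squares_le) auto
  finally show "(\<Sum>m\<in>{b<..N}. f m) \<le> 2 / (1 - \<beta>)\<^sup>2" by simp
qed (use assms kernel_nonneg in auto)

text \<open>Upper half of the evaluation, valid for every \<open>N\<close>: telescoping, dropping
  the nonnegative boundary terms and bounding the inner functions by induction leaves a sum over
  \<open>m \<le> K\<close> and a remainder that vanishes as \<open>K\<close> grows.\<close>

lemma partial_gf_le: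
  assumes "set as \<subseteq> {0..1}" "0 \<le> \<beta>" "\<beta> < 1"
  shows "partial_gf as (\<beta> - real k) N \<le> lim (chain (kernels \<beta> as) k)"
  using assms(1)
proof (induction as arbitrary: k)
  case Nil
  then show ?case by (simp add: partial_gf_def kernels_def)
next
  case (Cons a as)
  define g where "g m = 1 / ((real m - \<beta>) * (real m - \<beta> + a))" for m
  define D where "D as k = lim (chain (kernels \<beta> as) k)" for as k
  have kern: "kernels \<beta> (a # as) = g # kernels \<beta> as"
    by (simp add: kernels_def g_def[abs_def])
  have g0: "0 \<le> g m" if "k < m" for m
    using kernel_nonneg[of g \<beta> "a # as" m] Cons.prems assms(3) that by (simp add: kern)
  have lim: "chain (kernels \<beta> bs) k \<longlonglongrightarrow> D bs k" if "set bs \<subseteq> {0..1}" for bs k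
    unfolding D_def using kernel_chain_convergent[OF that assms(2,3)]
    by (simp add: convergent_LIMSEQ_iff)
  have sum_le: "(\<Sum>m\<in>{k<..K}. g m * D as m) \<le> D (a # as) k" for K
  proof (rule LIMSEQ_le)
    show "(\<lambda>M. \<Sum>m\<in>{k<..K}. g m * chain (kernels \<beta> as) m M) \<longlonglongrightarrow> (\<Sum>m\<in>{k<..K}. g m * D as m)"
      using Cons.prems by (intro tendsto_sum tendsto_mult_left lim) auto
    show "chain (kernels \<beta> (a # as)) k \<longlonglongrightarrow> D (a # as) k"
      by (rule lim[OF Cons.prems])
    have "(\<Sum>m\<in>{k<..K}. g m * chain (kernels \<beta> as) m M) \<le> chain (kernels \<beta> (a # as)) k M" if "K \<le> M" for M
      unfolding kern chain.simps using that Cons.prems assms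
      by (intro sum_mono2 mult_nonneg_nonneg chain_nonneg g0) (auto intro: kernel_nonneg)
    then show "\<exists>M0. \<forall>M\<ge>M0. (\<Sum>m\<in>{k<..K}. g m * chain (kernels \<beta> as) m M) \<le> chain (kernels \<beta> (a # as)) k M"
      by blast
  qed
  have "partial_gf (a # as) (\<beta> - real k) N \<le> partial_gf (a # as) (\<beta> - real K) N + D (a # as) k" if "k \<le> K" for K
  proof -
    have "(\<Sum>m\<in>{k<..K}. g m * partial_gf as (\<beta> - real m) N -
        numer (a # as) N / pochhammer (real m - \<beta>) (Suc N) / (real m - \<beta> + a)) \<le> (\<Sum>m\<in>{k<..K}. g m * D as m)"
    proof (rule sum_mono)
      fix m assume "m \<in> {k<..K}"
      then have m: "k < m" "real m - \<beta> > 0" using assms by auto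
      have "0 \<le> numer (a # as) N / pochhammer (real m - \<beta>) (Suc N) / (real m - \<beta> + a)"
        using m Cons.prems pochhammer_pos[OF m(2), of "Suc N"]
        by (intro divide_nonneg_nonneg numer_nonneg) (auto simp del: pochhammer_Suc)
      moreover have "g m * partial_gf as (\<beta> - real m) N \<le> g m * D as m"
        unfolding D_def using Cons.prems by (intro mult_left_mono Cons.IH g0 m) auto
      ultimately show "g m * partial_gf as (\<beta> - real m) N -
        numer (a # as) N / pochhammer (real m - \<beta>) (Suc N) / (real m - \<beta> + a) \<le> g m * D as m"
        by linarith
    qed
    with sum_le[of K] show ?thesis
      using partial_gf_telescope[OF assms(3) _ that, of a as N] Cons.prems by (simp add: g_def)
  qed
  moreover have "(\<lambda>K. partial_gf (a # as) (\<beta> - real K) N + D (a # as) k) \<longlonglongrightarrow> 0 + D (a # as) k"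
    using assms Cons.prems by (intro tendsto_add tendsto_const partial_gf_far_shift) auto
  ultimately have "partial_gf (a # as) (\<beta> - real k) N \<le> 0 + D (a # as) k"
    by (intro LIMSEQ_le_const) auto
  then show ?case by (simp add: D_def)
qed

text \<open>Lower half: for fixed \<open>K\<close> only finitely many boundary terms occur, and they
  vanish as \<open>N\<close> grows, while the remainder at \<open>K\<close> is nonnegative. The
  minorant \<open>h\<close> replaces a statement about lower limits and passes through the
  induction.\<close>

lemma partial_gf_ge:
  assumes "set as \<subseteq> {0..1}" "0 \<le> \<beta>" "\<beta> < 1"
  shows "\<exists>h. h \<longlonglongrightarrow> chain (kernels \<beta> as) k K \<and> (\<forall>N. h N \<le> partial_gf as (\<beta> - real k) N)"
  using assms(1)
proof (induction as arbitrary: k)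
  case Nil
  then show ?case by (auto simp: partial_gf_def kernels_def intro!: exI[of _ "\<lambda>_. 1"])
next
  case (Cons a as)
  define g where "g m = 1 / ((real m - \<beta>) * (real m - \<beta> + a))" for m
  have kern: "kernels \<beta> (a # as) = g # kernels \<beta> as"
    by (simp add: kernels_def g_def[abs_def])
  have g0: "0 \<le> g m" if "k < m" for m
    using kernel_nonneg[of g \<beta> "a # as" m] Cons.prems assms(3) that by (simp add: kern)
  have "\<forall>m. \<exists>h. h \<longlonglongrightarrow> chain (kernels \<beta> as) m K \<and> (\<forall>N. h N \<le> partial_gf as (\<beta> - real m) N)"
    using Cons by auto
  then obtain h where h: "\<And>m. h m \<longlonglongrightarrow> chain (kernels \<beta> as) m K"
    "\<And>m N. h m N \<le> partial_gf as (\<beta> - real m) N" by metis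
  define H where "H N = (\<Sum>m\<in>{k<..K}. g m * h m N -
        numer (a # as) N / pochhammer (real m - \<beta>) (Suc N) / (real m - \<beta> + a))" for N
  have "H \<longlonglongrightarrow> (\<Sum>m\<in>{k<..K}. g m * chain (kernels \<beta> as) m K - 0 / (real m - \<beta> + a))"
    unfolding H_def
  proof (intro tendsto_sum tendsto_diff tendsto_mult_left tendsto_divide tendsto_const h boundary_tendsto_0 Cons.prems)
    fix m assume "m \<in> {k<..K}"
    then have "1 \<le> real m" by auto
    then show "0 < real m - \<beta>" using assms by linarith
    then show "real m - \<beta> + a \<noteq> 0" using Cons.prems by auto
  qed
  then have "H \<longlonglongrightarrow> chain (kernels \<beta> (a # as)) k K" by (simp add: kern)
  moreover have "H N \<le> partial_gf (a # as) (\<beta> - real k) N" for N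
  proof (cases "k \<le> K")
    case True
    have "H N \<le> (\<Sum>m\<in>{k<..K}. g m * partial_gf as (\<beta> - real m) N -
        numer (a # as) N / pochhammer (real m - \<beta>) (Suc N) / (real m - \<beta> + a))"
      unfolding H_def by (intro sum_mono diff_right_mono mult_left_mono h g0) auto
    moreover have "0 \<le> partial_gf (a # as) (\<beta> - real K) N"
      using Cons.prems assms by (intro partial_gf_nonneg) auto
    ultimately show ?thesis
      using partial_gf_telescope[OF assms(3) _ True, of a as N] Cons.prems by (simp add: g_def)
  next
    case False
    then have "H N = 0" by (simp add: H_def)
    also have "0 \<le> partial_gf (a # as) (\<beta> - real k) N"
      using Cons.prems assms by (intro partial_gf_nonneg) auto
    finally show ?thesis .
  qed
  ultimately show ?case by blast
qed

text \<open>The upper bound holds for all \<open>N\<close>; the lower bound exceeds any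
  \<open>c\<close> below the limit once \<open>K\<close> and then \<open>N\<close> are
  large.\<close>

lemma partial_gf_tendsto:
  assumes "set as \<subseteq> {0..1}" "0 \<le> \<beta>" "\<beta> < 1"
  shows "partial_gf as \<beta> \<longlonglongrightarrow> lim (chain (kernels \<beta> as) 0)"
proof (rule order_tendstoI)
  fix c assume c: "c < lim (chain (kernels \<beta> as) 0)"
  have "chain (kernels \<beta> as) 0 \<longlonglongrightarrow> lim (chain (kernels \<beta> as) 0)"
    using kernel_chain_convergent[OF assms] by (simp add: convergent_LIMSEQ_iff)
  then have "eventually (\<lambda>K. c < chain (kernels \<beta> as) 0 K) sequentially"
    using c by (rule order_tendstoD)
  then obtain K where K: "c < chain (kernels \<beta> as) 0 K"
    by (auto dest: eventually_happens)
  obtain h where h: "h \<longlonglongrightarrow> chain (kernels \<beta> as) 0 K" "\<And>N. h N \<le> partial_gf as \<beta> N"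
    using partial_gf_ge[OF assms, of 0 K] by auto
  show "eventually (\<lambda>N. c < partial_gf as \<beta> N) sequentially"
    using order_tendstoD(1)[OF h(1) K] by eventually_elim (use h(2) less_le_trans in blast)
next
  fix c assume "lim (chain (kernels \<beta> as) 0) < c"
  then show "eventually (\<lambda>N. partial_gf as \<beta> N < c) sequentially"
    using partial_gf_le[OF assms, of 0] by (intro always_eventually) (auto intro: le_less_trans)
qed

section \<open>Zigzag sums\<close>

unbundle no vec_syntax
unbundle fps_syntax

section \<open>Operators that build zigzags entry by entry\<close>

definition below :: "nat \<Rightarrow> (nat \<Rightarrow> 'a::comm_ring_1) \<Rightarrow> nat \<Rightarrow> 'a" where
  "below N h c = (\<Sum>b | b \<in> {1..N} \<and> b < c. h b)"

definition above :: "nat \<Rightarrow> (nat \<Rightarrow> 'a::comm_ring_1) \<Rightarrow> nat \<Rightarrow> 'a" where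
  "above N h c = (\<Sum>b | b \<in> {1..N} \<and> c \<le> b. h b)"

text \<open>Like \<open>ascend\<close>, this adds one entry weighted by \<open>e\<close>. In
  \<open>descend\<close> the new smaller entry is summed over, so its weight stays inside; in
  \<open>ascend\<close> the argument is the new entry itself and the sum runs over the next larger
  one.\<close>

definition descend :: "nat \<Rightarrow> (nat \<Rightarrow> 'a::comm_ring_1) \<Rightarrow> (nat \<Rightarrow> 'a) \<Rightarrow> nat \<Rightarrow> 'a" where
  "descend N e f = below N (\<lambda>a. e a * f a)"

definition ascend :: "nat \<Rightarrow> (nat \<Rightarrow> 'a::comm_ring_1) \<Rightarrow> (nat \<Rightarrow> 'a) \<Rightarrow> nat \<Rightarrow> 'a" where
  "ascend N e g b = e b * above N g b"

text \<open>Weight of a row as a function of its first entry: \<open>s\<close> ascending steps up to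
  the peak, \<open>t\<close> at the peak, \<open>p\<close> descending steps, and \<open>f\<close> at
  the smallest entry of the descent, which is the peak itself if \<open>p = 0\<close>.\<close>

definition row_weight ::
  "nat \<Rightarrow> (nat \<Rightarrow> 'a::comm_ring_1) \<Rightarrow> (nat \<Rightarrow> 'a) \<Rightarrow> nat \<Rightarrow> nat \<Rightarrow> (nat \<Rightarrow> 'a) \<Rightarrow> nat \<Rightarrow> 'a" where
  "row_weight N e t s p f = (ascend N e ^^ s) (\<lambda>m. t m * (descend N e ^^ p) f m)"

text \<open>A row is encoded as the pair \<open>(s, r - 1)\<close>; the last argument of \<open>ribbon\<close> is a strict upper
  bound for the first entry \<open>b\<^sub>1\<^sub>,\<^sub>1\<close>.\<close>

fun ribbon ::
  "nat \<Rightarrow> (nat \<Rightarrow> 'a::comm_ring_1) \<Rightarrow> (nat \<Rightarrow> 'a) \<Rightarrow> (nat \<times> nat) list \<Rightarrow> nat \<Rightarrow> 'a" where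
  "ribbon N e t [] = (\<lambda>_. 1)"
| "ribbon N e t ((s, p) # rs) = below N (row_weight N e t s p (ribbon N e t rs))"

lemma below_beyond: "N < c \<Longrightarrow> below N h c = (\<Sum>b\<in>{1..N}. h b)"
  unfolding below_def by (rule sum.cong) auto

lemma below_plus_above: "below N h c + above N h c = (\<Sum>b\<in>{1..N}. h b)"
proof -
  have "{1..N} = {b. b \<in> {1..N} \<and> b < c} \<union> {b. b \<in> {1..N} \<and> c \<le> b}" by auto
  then show ?thesis unfolding below_def above_def
    by (metis (no_types, lifting) disjoint_iff finite_Un finite_atLeastAtMost leD mem_Collect_eq sum.union_disjoint)
qed

lemma below_add: "below N (\<lambda>b. f b + g b) c = below N f c + below N g c"
  by (simp add: below_def sum.distrib)

lemma below_scale: "below N (\<lambda>b. k * f b) c = k * below N f c"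
  by (simp add: below_def sum_distrib_left)

lemma below_sum: "below N (\<lambda>b. \<Sum>i\<in>I. f i b) c = (\<Sum>i\<in>I. below N (f i) c)"
  unfolding below_def by (rule sum.swap)

lemma below_Suc: "1 \<le> c \<Longrightarrow> c \<le> N \<Longrightarrow> below N h (Suc c) = below N h c + h c"
proof -
  assume "1 \<le> c" "c \<le> N"
  then have "{b. b \<in> {1..N} \<and> b < Suc c} = insert c {b. b \<in> {1..N} \<and> b < c}" by auto
  then show ?thesis by (simp add: below_def add.commute)
qed

lemma below_1 [simp]: "below N h (Suc 0) = 0"
  unfolding below_def by (rule sum.neutral) auto

lemma descend_add: "descend N e (\<lambda>b. f b + g b) = (\<lambda>c. descend N e f c + descend N e g c)"
  by (simp add: descend_def distrib_left below_add fun_eq_iff)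

lemma descend_scale: "descend N e (\<lambda>b. k * f b) = (\<lambda>c. k * descend N e f c)"
  by (simp add: descend_def mult.left_commute[of _ k] below_scale fun_eq_iff)

lemma descend_pow_add:
  "(descend N e ^^ p) (\<lambda>b. f b + g b) = (\<lambda>c. (descend N e ^^ p) f c + (descend N e ^^ p) g c)"
  by (induction p) (simp_all add: descend_add)

lemma descend_pow_scale:
  "(descend N e ^^ p) (\<lambda>b. k * f b) = (\<lambda>c. k * (descend N e ^^ p) f c)"
  by (induction p) (simp_all add: descend_scale)

lemma descend_pow_sum:
  "(descend N e ^^ p) (\<lambda>b. \<Sum>i\<in>I. f i b) = (\<lambda>c. \<Sum>i\<in>I. (descend N e ^^ p) (f i) c)"
  by (induction p) (simp_all add: descend_def sum_distrib_left below_sum)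

lemma ascend_add: "ascend N e (\<lambda>b. f b + g b) = (\<lambda>c. ascend N e f c + ascend N e g c)"
  by (simp add: ascend_def above_def sum.distrib distrib_left fun_eq_iff)

lemma ascend_scale: "ascend N e (\<lambda>b. k * f b) = (\<lambda>c. k * ascend N e f c)"
  by (simp add: ascend_def above_def sum_distrib_left mult.left_commute fun_eq_iff)

lemma row_weight_add:
  "row_weight N e t s p (\<lambda>b. f b + g b) = (\<lambda>c. row_weight N e t s p f c + row_weight N e t s p g c)"
  unfolding row_weight_def by (induction s) (simp_all add: ascend_add descend_pow_add distrib_left)

lemma row_weight_scale:
  "row_weight N e t s p (\<lambda>b. k * f b) = (\<lambda>c. k * row_weight N e t s p f c)"
  unfolding row_weight_def by (induction s) (simp_all add: ascend_scale descend_pow_scale mult.left_commute)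

lemma row_weight_Suc_descend: "row_weight N e t s (Suc p) f = row_weight N e t s p (descend N e f)"
  by (simp add: row_weight_def funpow_swap1)

lemma row_weight_Suc_ascend: "row_weight N e t (Suc s) p f = ascend N e (row_weight N e t s p f)"
  by (simp add: row_weight_def)

text \<open>An entry weighted by \<open>e\<close> separates the row from what \<open>h\<close>
  describes. The first variable of \<open>h\<close> is either at least that entry, which then starts
  the ascent of the next row, or below it, and then the entry ends the descent of the current row;
  together no condition is left.\<close>

lemma row_weight_cut:
  "row_weight N e t s p (below N (ascend N e h)) c + row_weight N e t s (Suc p) (below N h) c =
     (\<Sum>b\<in>{1..N}. h b) * row_weight N e t s (Suc p) (\<lambda>_. 1) c"
proof -
  have "below N (ascend N e h) c + descend N e (below N h) c = (\<Sum>b\<in>{1..N}. h b) * descend N e (\<lambda>_. 1) c" for c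
  proof -
    have "below N (ascend N e h) c + descend N e (below N h) c =
        below N (\<lambda>b. e b * (below N h b + above N h b)) c"
      by (simp add: ascend_def descend_def below_add[symmetric] distrib_left add.commute)
    also have "\<dots> = (\<Sum>b\<in>{1..N}. h b) * descend N e (\<lambda>_. 1) c"
      by (simp add: below_plus_above descend_def mult.commute[of "e _"] below_scale)
    finally show ?thesis .
  qed
  then show ?thesis
    unfolding row_weight_Suc_descend
    by (simp add: row_weight_add[THEN fun_cong, symmetric] row_weight_scale[THEN fun_cong, symmetric])
qed

text \<open>The sum of the two ribbons drops the condition between two adjacent rs: the entry
  \<open>a\<^sub>i\<^sub>,\<^sub>1\<close> is either larger than \<open>b\<^sub>i\<^sub>+\<^sub>1\<^sub>,\<^sub>1\<close>, or it can be moved in front of it.\<close>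

lemma ribbon_cut:
  "ribbon N e t (pre @ (s, p) # (Suc s', p') # post) c + ribbon N e t (pre @ (s, Suc p) # (s', p') # post) c =
     ribbon N e t (pre @ [(s, Suc p)]) c * ribbon N e t ((s', p') # post) (Suc N)"
proof (induction pre arbitrary: c)
  case Nil
  show ?case
    by (simp add: row_weight_Suc_ascend below_add[symmetric] row_weight_cut below_scale below_beyond mult.commute[of _ "sum _ _"])
next
  case (Cons sp pre)
  obtain s0 p0 where "sp = (s0, p0)" by force
  then show ?case
    by (simp only: append_Cons ribbon.simps below_add[symmetric] row_weight_add[THEN fun_cong, symmetric] Cons)
      (simp add: mult.commute[of _ "below N _ (Suc N)"] row_weight_scale below_scale)
qed

section \<open>Generating functions modulo high powers of the variable\<close>

fun linear_gf :: "(nat \<Rightarrow> 'a::comm_ring_1) \<Rightarrow> (nat \<Rightarrow> 'a) \<Rightarrow> 'a list \<Rightarrow> nat \<Rightarrow> 'a" where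
  "linear_gf e t [] i = 0"
| "linear_gf e t (z # zs) 0 = (if zs = [] then 1 else 0)"
| "linear_gf e t (z # zs) (Suc i) =
     (1 + z * e (Suc i)) * linear_gf e t (z # zs) i + t (Suc i) * linear_gf e t zs i"

fun hom_sym :: "(nat \<Rightarrow> 'a::comm_ring_1) \<Rightarrow> nat \<Rightarrow> nat \<Rightarrow> 'a" where
  "hom_sym e 0 m = 1"
| "hom_sym e (Suc s) m = (\<Sum>b\<in>{1..m}. e b * hom_sym e s b)"

text \<open>Summing from the peak \<open>m\<close> instead of from the bottom separates the ascent
  from the rest; \<open>hom_sym e s m\<close> is the complete homogeneous symmetric polynomial of
  degree \<open>s\<close> in \<open>e 1\<close>, ..., \<open>e m\<close>.\<close>

lemma sum_ascend_pow:
  "(\<Sum>b\<in>{1..N}. (ascend N e ^^ s) g b) = (\<Sum>m\<in>{1..N}. g m * hom_sym e s m)"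
proof (induction s arbitrary: g)
  case (Suc s)
  have "(\<Sum>b\<in>{1..N}. (ascend N e ^^ Suc s) g b) =
      (\<Sum>b\<in>{1..N}. \<Sum>m | m \<in> {1..N} \<and> b \<le> m. g m * (e b * hom_sym e s b))"
    unfolding funpow_Suc_right comp_apply Suc
    by (simp add: ascend_def above_def sum_distrib_left sum_distrib_right mult_ac)
  also have "\<dots> = (\<Sum>m\<in>{1..N}. \<Sum>b | b \<in> {1..N} \<and> b \<le> m. g m * (e b * hom_sym e s b))"
    by (rule sum.swap_restrict) auto
  also have "\<dots> = (\<Sum>m\<in>{1..N}. g m * hom_sym e (Suc s) m)"
    unfolding hom_sym.simps sum_distrib_left by (intro sum.cong refl) auto
  finally show ?case .
qed simp

text \<open>Generating sums over \<open>s\<close> and the other exponents stop at \<open>B\<close>,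
  so identities hold only up to the coefficient of x^B; entries without constant term make the
  discarded terms divisible by higher powers.\<close>

definition fps_cong :: "nat \<Rightarrow> 'a::comm_ring_1 fps \<Rightarrow> 'a fps \<Rightarrow> bool" where
  "fps_cong B f g \<longleftrightarrow> (\<forall>i\<le>B. f $ i = g $ i)"

lemma fps_cong_refl [simp]: "fps_cong B f f"
  by (simp add: fps_cong_def)

lemma fps_cong_trans [trans]: "fps_cong B f g \<Longrightarrow> fps_cong B g h \<Longrightarrow> fps_cong B f h"
  by (simp add: fps_cong_def)

lemma fps_cong_add: "fps_cong B f g \<Longrightarrow> fps_cong B f' g' \<Longrightarrow> fps_cong B (f + f') (g + g')"
  by (simp add: fps_cong_def)

lemma fps_cong_mult: "fps_cong B f g \<Longrightarrow> fps_cong B f' g' \<Longrightarrow> fps_cong B (f * f') (g * g')"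
  by (auto simp: fps_cong_def fps_mult_nth intro!: sum.cong)

lemma fps_cong_sum: "(\<And>i. i \<in> I \<Longrightarrow> fps_cong B (f i) (g i)) \<Longrightarrow> fps_cong B (sum f I) (sum g I)"
  by (auto simp: fps_cong_def fps_sum_nth intro!: sum.cong)

lemma fps_mult_nth_vanish:
  fixes f g :: "'a::comm_ring_1 fps"
  assumes "f $ 0 = 0" "\<And>i. i < p \<Longrightarrow> g $ i = 0" "i < Suc p"
  shows "(f * g) $ i = 0"
  unfolding fps_mult_nth
proof (intro sum.neutral ballI)
  fix j assume "j \<in> {0..i}"
  then show "f $ j * g $ (i - j) = 0" using assms by (cases j) auto
qed

lemma descend_pow_vanish:
  fixes e :: "nat \<Rightarrow> 'a::comm_ring_1 fps"
  assumes "\<And>b. e b $ 0 = 0" "i < p"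
  shows "(descend N e ^^ p) f c $ i = 0"
  using assms(2)
proof (induction p arbitrary: i c)
  case (Suc p)
  then have "(e b * (descend N e ^^ p) f b) $ i = 0" for b
    by (intro fps_mult_nth_vanish[of _ p] assms) auto
  then show ?case
    by (simp add: descend_def[of N e "(descend N e ^^ p) f"] below_def fps_sum_nth)
qed simp

lemma hom_sym_vanish:
  fixes e :: "nat \<Rightarrow> 'a::comm_ring_1 fps"
  assumes "\<And>b. e b $ 0 = 0" "i < s"
  shows "hom_sym e s m $ i = 0"
  using assms(2)
proof (induction s arbitrary: i m)
  case (Suc s)
  then have "(e b * hom_sym e s b) $ i = 0" for b
    by (intro fps_mult_nth_vanish[of _ s] assms) auto
  then show ?case
    by (simp add: fps_sum_nth)
qed simp

text \<open>The product formula for the complete homogeneous generating function, with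
  \<open>q b\<close> as the inverse of \<open>1 - y * e b\<close>. Stopping at \<open>s = B\<close>
  leaves an error with \<open>B + 1\<close> factors that have no constant term.\<close>

lemma hom_sym_gf_cong:
  fixes e q :: "nat \<Rightarrow> 'a::comm_ring_1 fps"
  assumes "\<And>b. e b $ 0 = 0" and q: "\<And>b. 1 \<le> b \<Longrightarrow> q b * (1 - y * e b) = 1"
  shows "fps_cong B (\<Sum>s\<le>B. y ^ s * hom_sym e s m) (\<Prod>b\<in>{1..m}. q b)"
proof (induction m)
  case 0
  have "(\<Sum>s\<le>B. y ^ s * hom_sym e s 0) = 1"
    by (subst sum.atMost_shift) simp
  then show ?case by simp
next
  case (Suc m)
  define K where "K m = (\<Sum>s\<le>B. y ^ s * hom_sym e s m)" for m
  define x where "x = y * e (Suc m)"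
  have ym: "hom_sym e (Suc s) (Suc m) = hom_sym e (Suc s) m + e (Suc m) * hom_sym e s (Suc m)" for s
    by (simp add: add.commute)
  have "K (Suc m) = 1 + (\<Sum>s<B. y ^ Suc s * hom_sym e (Suc s) (Suc m))"
    unfolding K_def by (subst sum.atMost_shift) simp
  also have "\<dots> = 1 + (\<Sum>s<B. y ^ Suc s * hom_sym e (Suc s) m) + x * (\<Sum>s<B. y ^ s * hom_sym e s (Suc m))"
    by (simp only: ym x_def) (simp add: algebra_simps sum.distrib sum_distrib_left)
  also have "1 + (\<Sum>s<B. y ^ Suc s * hom_sym e (Suc s) m) = K m"
    unfolding K_def sum.atMost_shift by simp
  also have "(\<Sum>s<B. y ^ s * hom_sym e s (Suc m)) = K (Suc m) - y ^ B * hom_sym e B (Suc m)"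
    unfolding K_def lessThan_Suc_atMost[symmetric] by simp
  finally have "K (Suc m) * (1 - x) = K m - y ^ Suc B * (e (Suc m) * hom_sym e B (Suc m))"
    by (simp add: x_def algebra_simps)
  moreover have "q (Suc m) * (1 - x) = 1"
    unfolding x_def using q by simp
  ultimately have "K (Suc m) = q (Suc m) * (K m - y ^ Suc B * (e (Suc m) * hom_sym e B (Suc m)))"
    by (metis mult.left_commute mult.right_neutral)
  also have "fps_cong B \<dots> (q (Suc m) * K m)"
  proof (rule fps_cong_mult)
    have "(y ^ Suc B * (e (Suc m) * hom_sym e B (Suc m))) $ i = 0" if "i \<le> B" for i
      unfolding fps_mult_nth[of "y ^ Suc B"] using that
      by (intro sum.neutral ballI) (simp add: fps_mult_nth_vanish[of _ B] assms hom_sym_vanish)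
    then show "fps_cong B (K m - y ^ Suc B * (e (Suc m) * hom_sym e B (Suc m))) (K m)"
      by (simp add: fps_cong_def)
  qed simp
  also have "fps_cong B \<dots> (q (Suc m) * (\<Prod>b\<in>{1..m}. q b))"
    by (rule fps_cong_mult) (use Suc in \<open>simp_all add: K_def\<close>)
  finally show ?case by (simp add: K_def mult.commute)
qed

definition flat_gf ::
  "nat \<Rightarrow> (nat \<Rightarrow> 'a::comm_ring_1) \<Rightarrow> (nat \<Rightarrow> 'a) \<Rightarrow> nat \<Rightarrow> 'a list \<Rightarrow> nat \<Rightarrow> 'a" where
  "flat_gf N e t B zs c =
     (\<Sum>ps\<in>exps B (length zs). monomial zs ps * ribbon N e t (map (Pair 0) ps) c)"

text \<open>What remains of \<open>flat_gf\<close> when the first peak is removed: a descent marked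
  by \<open>z\<close> hangs below the bound \<open>c\<close>.\<close>

definition top_gf ::
  "nat \<Rightarrow> (nat \<Rightarrow> 'a::comm_ring_1) \<Rightarrow> (nat \<Rightarrow> 'a) \<Rightarrow> nat \<Rightarrow> 'a \<Rightarrow> 'a list \<Rightarrow> nat \<Rightarrow> 'a" where
  "top_gf N e t B z zs c = (\<Sum>p\<le>B. z ^ p * (descend N e ^^ p) (flat_gf N e t B zs) c)"

lemma flat_gf_Nil: "flat_gf N e t B [] c = 1"
  by (simp add: flat_gf_def)

lemma flat_gf_Cons: "flat_gf N e t B (z # zs) c = below N (\<lambda>m. t m * top_gf N e t B z zs m) c"
proof -
  have "flat_gf N e t B (z # zs) c =
      (\<Sum>p\<le>B. \<Sum>ps\<in>exps B (length zs). z ^ p * (monomial zs ps *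
         below N (\<lambda>m. t m * (descend N e ^^ p) (ribbon N e t (map (Pair 0) ps)) m) c))"
    by (simp add: flat_gf_def sum_exps_Suc row_weight_def mult.assoc)
  also have "\<dots> = below N (\<lambda>m. \<Sum>p\<le>B. \<Sum>ps\<in>exps B (length zs). z ^ p * (monomial zs ps *
         (t m * (descend N e ^^ p) (ribbon N e t (map (Pair 0) ps)) m))) c"
    by (simp add: below_sum below_scale)
  also have "\<dots> = below N (\<lambda>m. t m * top_gf N e t B z zs m) c"
    unfolding top_gf_def flat_gf_def[abs_def] descend_pow_sum descend_pow_scale
    by (simp add: sum_distrib_left mult_ac)
  finally show ?thesis .
qed

text \<open>A geometric sum in the operator \<open>z * descend\<close>, cut off at \<open>B\<close>;
  the last term is the cutoff error.\<close>

lemma top_gf_rec: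
  "top_gf N e t B z zs c = flat_gf N e t B zs c + z * descend N e (top_gf N e t B z zs) c -
     z ^ Suc B * (descend N e ^^ Suc B) (flat_gf N e t B zs) c"
proof -
  define G where "G = flat_gf N e t B zs"
  have "z * descend N e (top_gf N e t B z zs) c = (\<Sum>p\<le>B. z ^ Suc p * (descend N e ^^ Suc p) G c)"
    unfolding top_gf_def[abs_def] G_def[symmetric]
    by (simp add: descend_def sum_distrib_left below_sum below_scale mult.assoc
        mult.left_commute[of "e _"])
  moreover have "(\<Sum>p\<le>Suc B. z ^ p * (descend N e ^^ p) G c) =
      G c + (\<Sum>p\<le>B. z ^ Suc p * (descend N e ^^ Suc p) G c)"
    by (subst sum.atMost_Suc_shift) simp
  moreover have "(\<Sum>p\<le>Suc B. z ^ p * (descend N e ^^ p) G c) =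
      top_gf N e t B z zs c + z ^ Suc B * (descend N e ^^ Suc B) G c"
    by (simp add: top_gf_def G_def)
  ultimately show ?thesis unfolding G_def by (simp add: algebra_simps)
qed

text \<open>Raising the bound admits one more integer, \<open>Suc i\<close>. It is absent or an
  entry of the strictly decreasing run, which gives the factor \<open>1 + z * e (Suc i)\<close>, or
  it is the next peak, which gives \<open>t (Suc i)\<close>. The hypothesis on the increments of
  \<open>flat_gf\<close> encodes the result for the shorter list.\<close>

lemma top_gf_cong_step:
  fixes e t :: "nat \<Rightarrow> 'a::comm_ring_1 fps"
  assumes e0: "\<And>b. e b $ 0 = 0" and "i \<le> N"
    and G: "\<And>i. i < N \<Longrightarrow> fps_cong B (flat_gf N e t B zs (Suc (Suc i)))
        (flat_gf N e t B zs (Suc i) + t (Suc i) * linear_gf e t zs i)"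
    and G1: "flat_gf N e t B zs (Suc 0) = (if zs = [] then 1 else 0)"
  shows "fps_cong B (top_gf N e t B z zs (Suc i)) (linear_gf e t (z # zs) i)"
  using assms(2)
proof (induction i)
  define G where "G = flat_gf N e t B zs"
  define T where "T = top_gf N e t B z zs"
  have rec: "fps_cong B (T c) (G c + z * descend N e T c)" for c
  proof -
    have "(z ^ Suc B * (descend N e ^^ Suc B) G c) $ i = 0" if "i \<le> B" for i
      unfolding fps_mult_nth[of "z ^ Suc B"]
    proof (intro sum.neutral ballI)
      fix j assume "j \<in> {0..i}"
      then have "(descend N e ^^ Suc B) G c $ (i - j) = 0"
        using that by (intro descend_pow_vanish e0) auto
      then show "z ^ Suc B $ j * (descend N e ^^ Suc B) G c $ (i - j) = 0" by simp
    qed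
    then show ?thesis
      unfolding T_def G_def by (subst top_gf_rec) (simp add: fps_cong_def)
  qed
  {
    case 0
    have "fps_cong B (T (Suc 0)) (G (Suc 0))"
      using rec[of "Suc 0"] by (simp add: descend_def)
    then show ?case by (simp add: T_def G_def G1)
  next
    case (Suc i)
    then have IH: "fps_cong B (T (Suc i)) (linear_gf e t (z # zs) i)" by (simp add: T_def)
    have "fps_cong B (T (Suc (Suc i))) (G (Suc (Suc i)) + z * (descend N e T (Suc i) + e (Suc i) * T (Suc i)))"
      using rec[of "Suc (Suc i)"] Suc.prems
      by (simp add: descend_def below_Suc[of "Suc i"])
    also have "fps_cong B \<dots>
        ((G (Suc i) + t (Suc i) * linear_gf e t zs i) + z * (descend N e T (Suc i) + e (Suc i) * T (Suc i)))"
      by (rule fps_cong_add) (use G[of i] Suc.prems in \<open>simp_all add: G_def\<close>)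
    also have "\<dots> = (G (Suc i) + z * descend N e T (Suc i)) + (t (Suc i) * linear_gf e t zs i + z * e (Suc i) * T (Suc i))"
      by (simp add: algebra_simps)
    also have "fps_cong B \<dots> (T (Suc i) + (t (Suc i) * linear_gf e t zs i + z * e (Suc i) * T (Suc i)))"
      using rec[of "Suc i"] by (intro fps_cong_add) (simp_all add: fps_cong_def)
    also have "fps_cong B \<dots> (linear_gf e t (z # zs) i +
        (t (Suc i) * linear_gf e t zs i + z * e (Suc i) * linear_gf e t (z # zs) i))"
      by (intro fps_cong_add fps_cong_mult IH fps_cong_refl)
    also have "\<dots> = linear_gf e t (z # zs) (Suc i)"
      by (simp add: algebra_simps)
    finally show ?case by (simp add: T_def)
  }
qed

lemma top_gf_cong:
  fixes e t :: "nat \<Rightarrow> 'a::comm_ring_1 fps"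
  assumes e0: "\<And>b. e b $ 0 = 0" and "i \<le> N"
  shows "fps_cong B (top_gf N e t B z zs (Suc i)) (linear_gf e t (z # zs) i)"
  using assms(2)
proof (induction zs arbitrary: z i)
  case (Nil z i)
  then show ?case by (intro top_gf_cong_step e0) (simp_all add: flat_gf_Nil)
next
  case (Cons z' zs z i)
  show ?case
  proof (rule top_gf_cong_step)
    fix j assume "j < N"
    then have "fps_cong B (t (Suc j) * top_gf N e t B z' zs (Suc j)) (t (Suc j) * linear_gf e t (z' # zs) j)"
      by (intro fps_cong_mult Cons.IH fps_cong_refl) simp
    then show "fps_cong B (flat_gf N e t B (z' # zs) (Suc (Suc j)))
        (flat_gf N e t B (z' # zs) (Suc j) + t (Suc j) * linear_gf e t (z' # zs) j)"
      using \<open>j < N\<close> unfolding flat_gf_Cons by (subst below_Suc) (auto intro: fps_cong_add)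
  qed (use Cons.prems e0 in \<open>simp_all add: flat_gf_Cons\<close>)
qed

fun hook_rows :: "nat list \<Rightarrow> (nat \<times> nat) list" where
  "hook_rows (s # p # ps) = (s, p) # map (Pair 0) ps"
| "hook_rows _ = []"

text \<open>With the peak \<open>m\<close> of the first row outermost, the ascent contributes the
  product of the \<open>q b\<close> and the part below the peak contributes
  \<open>linear_gf\<close>.\<close>

lemma hook_gf_cong:
  fixes e t q :: "nat \<Rightarrow> 'a::comm_ring_1 fps"
  assumes e0: "\<And>b. e b $ 0 = 0" and q: "\<And>b. 1 \<le> b \<Longrightarrow> q b * (1 - y * e b) = 1"
  shows "fps_cong B
    (\<Sum>ex\<in>exps B (Suc (Suc (length zs))). monomial (y # z # zs) ex * ribbon N e t (hook_rows ex) (Suc N))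
    (\<Sum>i<N. t (Suc i) * linear_gf e t (z # zs) i * (\<Prod>b\<in>{1..Suc i}. q b))"
proof -
  have "(\<Sum>ex\<in>exps B (Suc (Suc (length zs))). monomial (y # z # zs) ex * ribbon N e t (hook_rows ex) (Suc N)) =
     (\<Sum>s\<le>B. \<Sum>p\<le>B. \<Sum>ps\<in>exps B (length zs). \<Sum>m\<in>{1..N}. y ^ s * (z ^ p * (monomial zs ps *
        (t m * (descend N e ^^ p) (ribbon N e t (map (Pair 0) ps)) m * hom_sym e s m))))"
    by (simp add: sum_exps_Suc below_beyond row_weight_def sum_ascend_pow[unfolded One_nat_def] mult.assoc flip: sum_distrib_left)
  also have "\<dots> = (\<Sum>m\<in>{1..N}. \<Sum>s\<le>B. \<Sum>p\<le>B. \<Sum>ps\<in>exps B (length zs). y ^ s * (z ^ p * (monomial zs ps *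
        (t m * (descend N e ^^ p) (ribbon N e t (map (Pair 0) ps)) m * hom_sym e s m))))"
    by (simp only: sum.swap[of _ "{1..N}"])
  also have "\<dots> = (\<Sum>m\<in>{1..N}. t m * top_gf N e t B z zs m * (\<Sum>s\<le>B. y ^ s * hom_sym e s m))"
  proof (intro sum.cong refl)
    fix m
    have top: "top_gf N e t B z zs m = (\<Sum>p\<le>B. \<Sum>ps\<in>exps B (length zs).
        z ^ p * (monomial zs ps * (descend N e ^^ p) (ribbon N e t (map (Pair 0) ps)) m))"
      unfolding top_gf_def flat_gf_def[abs_def] descend_pow_sum descend_pow_scale
      by (simp add: sum_distrib_left)
    have "t m * top_gf N e t B z zs m * (\<Sum>s\<le>B. y ^ s * hom_sym e s m) =
        (\<Sum>s\<le>B. y ^ s * hom_sym e s m * t m * top_gf N e t B z zs m)"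
      by (simp add: sum_distrib_left mult_ac)
    also have "\<dots> = (\<Sum>s\<le>B. \<Sum>p\<le>B. \<Sum>ps\<in>exps B (length zs). y ^ s * (z ^ p * (monomial zs ps *
        (t m * (descend N e ^^ p) (ribbon N e t (map (Pair 0) ps)) m * hom_sym e s m))))"
      unfolding top sum_distrib_left by (simp add: mult_ac)
    finally show "(\<Sum>s\<le>B. \<Sum>p\<le>B. \<Sum>ps\<in>exps B (length zs). y ^ s * (z ^ p * (monomial zs ps *
        (t m * (descend N e ^^ p) (ribbon N e t (map (Pair 0) ps)) m * hom_sym e s m)))) =
        t m * top_gf N e t B z zs m * (\<Sum>s\<le>B. y ^ s * hom_sym e s m)" ..
  qed
  also have "\<dots> = (\<Sum>i<N. t (Suc i) * top_gf N e t B z zs (Suc i) * (\<Sum>s\<le>B. y ^ s * hom_sym e s (Suc i)))"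
    by (rule sum.reindex_bij_witness[of _ Suc "\<lambda>m. m - 1"]) auto
  also have "fps_cong B \<dots> (\<Sum>i<N. t (Suc i) * linear_gf e t (z # zs) i * (\<Prod>b\<in>{1..Suc i}. q b))"
    by (intro fps_cong_sum fps_cong_mult fps_cong_refl top_gf_cong hom_sym_gf_cong e0 q) auto
  finally show ?thesis .
qed

section \<open>Passing to the limit\<close>

text \<open>Expansion of x / (b - c x) for positive b; the case \<open>c = 1\<close> collects the
  powers 1 / b^k with k \<ge> 1.\<close>

definition geometric_fps :: "real \<Rightarrow> nat \<Rightarrow> real fps" where
  "geometric_fps c b = Abs_fps (\<lambda>k. if k = 0 then 0 else c ^ (k - 1) / real b ^ k)"

abbreviation entry_fps :: "nat \<Rightarrow> real fps" where
  "entry_fps \<equiv> geometric_fps 1"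

text \<open>Expansion of x^2 / (b (b - x)): the peak carries the last entry of an admissible index,
  which is at least \<open>2\<close>.\<close>

definition top_fps :: "nat \<Rightarrow> real fps" where
  "top_fps b = Abs_fps (\<lambda>k. if k < 2 then 0 else 1 / real b ^ k)"

text \<open>Equals (b - x) / (b - (1 + y) x), the inverse of 1 - y x / (b - x).\<close>

definition resolvent_fps :: "real \<Rightarrow> nat \<Rightarrow> real fps" where
  "resolvent_fps y b = 1 + fps_const y * geometric_fps (1 + y) b"

lemma geometric_fps_0 [simp]: "geometric_fps c b $ 0 = 0"
  by (simp add: geometric_fps_def)

lemma geometric_fps_eq:
  assumes "1 \<le> b"
  shows "(fps_const (real b) - fps_const c * fps_X) * geometric_fps c b = fps_X"
proof (rule fps_ext)
  fix k
  have "(fps_X * geometric_fps c b) $ k = (if k = 0 then 0 else geometric_fps c b $ (k - 1))"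
    by (simp add: fps_X_mult_nth)
  then show "((fps_const (real b) - fps_const c * fps_X) * geometric_fps c b) $ k = fps_X $ k"
    using assms
    by (cases k; cases "k - 1") (auto simp: left_diff_distrib mult.assoc geometric_fps_def fps_X_def)
qed

lemma resolvent_fps_eq:
  assumes "1 \<le> b"
  shows "resolvent_fps y b * (1 - fps_const y * entry_fps b) = 1"
proof -
  define P where "P c = fps_const (real b) - fps_const c * fps_X" for c
  have eq: "P c * geometric_fps c b = fps_X" for c
    unfolding P_def by (rule geometric_fps_eq[OF assms])
  have "P c $ 0 = real b" for c by (simp add: P_def)
  then have nz: "P c \<noteq> 0" for c using assms by (metis fps_zero_nth of_nat_0_eq_iff not_one_le_zero)
  have P1: "P (1 + y) + fps_const y * fps_X = P 1"
    by (simp add: P_def algebra_simps flip: fps_const_add)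
  \<comment> \<open>Clearing both denominators leaves a polynomial identity; they are nonzero and
    can be cancelled.\<close>
  have "(P (1 + y) * P 1) * (resolvent_fps y b * (1 - fps_const y * entry_fps b)) =
      (P (1 + y) + fps_const y * (P (1 + y) * geometric_fps (1 + y) b)) *
      (P 1 - fps_const y * (P 1 * entry_fps b))"
    unfolding resolvent_fps_def by (simp add: algebra_simps)
  also have "\<dots> = P 1 * (P 1 - fps_const y * fps_X)"
    unfolding eq P1 ..
  also have "\<dots> = (P (1 + y) * P 1) * 1"
    unfolding P1[symmetric] by (simp add: algebra_simps)
  finally show ?thesis using nz by (metis mult_cancel_left mult_eq_0_iff)
qed

section \<open>Evaluation of series with nonnegative coefficients at small positive
  arguments\<close>

definition fps_sums :: "real fps \<Rightarrow> real \<Rightarrow> real \<Rightarrow> bool" where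
  "fps_sums f x v \<longleftrightarrow> (\<forall>k. 0 \<le> f $ k) \<and> (\<lambda>k. f $ k * x ^ k) sums v"

lemma fps_sums_const [intro]: "0 \<le> c \<Longrightarrow> fps_sums (fps_const c) x c"
  unfolding fps_sums_def
  using sums_If_finite_set[of "{0}" "\<lambda>k. c * x ^ k"] by (auto simp: if_distrib if_distribR cong: if_cong)

lemma fps_sums_0: "fps_sums 0 x 0"
  using fps_sums_const[of 0 x] by simp

lemma fps_sums_1: "fps_sums 1 x 1"
  using fps_sums_const[of 1 x] by simp

lemma fps_sums_add: "fps_sums f x u \<Longrightarrow> fps_sums g x v \<Longrightarrow> fps_sums (f + g) x (u + v)"
  by (auto simp: fps_sums_def distrib_right intro!: sums_add)

lemma fps_sums_mult:
  assumes "fps_sums f x u" "fps_sums g x v" "0 \<le> x"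
  shows "fps_sums (f * g) x (u * v)"
proof -
  have f: "summable (\<lambda>k. norm (f $ k * x ^ k))" "(\<Sum>k. f $ k * x ^ k) = u"
    and g: "summable (\<lambda>k. norm (g $ k * x ^ k))" "(\<Sum>k. g $ k * x ^ k) = v"
    using assms by (auto simp: fps_sums_def sums_iff)
  have "(\<lambda>k. \<Sum>i\<le>k. (f $ i * x ^ i) * (g $ (k - i) * x ^ (k - i))) sums (u * v)"
    using Cauchy_product_sums[OF f(1) g(1)] by (simp only: f g)
  moreover have "(\<Sum>i\<le>k. (f $ i * x ^ i) * (g $ (k - i) * x ^ (k - i))) = (f * g) $ k * x ^ k" for k
    unfolding fps_mult_nth sum_distrib_right atLeast0AtMost
    by (intro sum.cong refl) (simp add: mult_ac flip: power_add)
  moreover have "0 \<le> (f * g) $ k" for k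
    using assms by (auto simp: fps_sums_def fps_mult_nth intro!: sum_nonneg)
  ultimately show ?thesis by (simp add: fps_sums_def)
qed

lemma fps_sums_sum:
  "(\<And>i. i \<in> I \<Longrightarrow> fps_sums (f i) x (v i)) \<Longrightarrow> fps_sums (sum f I) x (sum v I)"
  by (induction I rule: infinite_finite_induct) (auto intro: fps_sums_add fps_sums_0)

lemma fps_sums_prod:
  "(\<And>i. i \<in> I \<Longrightarrow> fps_sums (f i) x (v i)) \<Longrightarrow> 0 \<le> x \<Longrightarrow> fps_sums (prod f I) x (prod v I)"
  by (induction I rule: infinite_finite_induct) (auto intro: fps_sums_mult fps_sums_1)

lemma fps_sums_geometric:
  assumes "0 \<le> c" "0 \<le> x" "x * c < real b"
  shows "fps_sums (geometric_fps c b) x (x / (real b - x * c))"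
proof -
  have b: "0 < real b" using assms by (smt (verit) mult_nonneg_nonneg)
  have "(\<lambda>k. x / real b * (x * c / real b) ^ k) sums (x / real b * (1 / (1 - x * c / real b)))"
    using assms b by (intro sums_mult geometric_sums) (simp add: divide_simps)
  also have "x / real b * (1 / (1 - x * c / real b)) = x / (real b - x * c)"
    using b assms by (simp add: field_simps)
  also have "(\<lambda>k. x / real b * (x * c / real b) ^ k) = (\<lambda>k. geometric_fps c b $ Suc k * x ^ Suc k)"
    by (simp add: geometric_fps_def fun_eq_iff power_mult_distrib power_divide mult_ac)
  finally have "(\<lambda>k. geometric_fps c b $ k * x ^ k) sums (x / (real b - x * c))"
    by (subst (asm) sums_Suc_iff) simp
  then show ?thesis using assms by (simp add: fps_sums_def geometric_fps_def)
qed

lemma fps_sums_top: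
  assumes "0 \<le> x" "x < real b"
  shows "fps_sums (top_fps b) x (x\<^sup>2 / (real b * (real b - x)))"
proof -
  have "(\<lambda>k. entry_fps b $ k * x ^ k) sums (x / (real b - x))"
    using fps_sums_geometric[of 1 x b] assms by (simp add: fps_sums_def)
  moreover have "(\<lambda>k. if k = 1 then x / real b else 0) sums (x / real b)"
    using sums_single[of 1 "\<lambda>_. x / real b"] by simp
  ultimately have "(\<lambda>k. entry_fps b $ k * x ^ k - (if k = 1 then x / real b else 0)) sums
      (x / (real b - x) - x / real b)"
    by (rule sums_diff)
  also have "(\<lambda>k. entry_fps b $ k * x ^ k - (if k = 1 then x / real b else 0)) = (\<lambda>k. top_fps b $ k * x ^ k)"
    by (auto simp: fun_eq_iff geometric_fps_def top_fps_def numeral_2_eq_2 less_Suc_eq)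
  also have "x / (real b - x) - x / real b = x\<^sup>2 / (real b * (real b - x))"
    using assms by (simp add: divide_simps power2_eq_square) (simp add: algebra_simps)
  finally show ?thesis by (simp add: fps_sums_def top_fps_def)
qed

lemma fps_sums_linear_gf:
  assumes "set zs \<subseteq> {0..1}" "0 \<le> x" "x < 1"
  shows "fps_sums (linear_gf entry_fps top_fps (map fps_const zs) i) x
    (linear_gf (\<lambda>b. x / (real b - x)) (\<lambda>b. x\<^sup>2 / (real b * (real b - x))) zs i)"
  using assms(1)
proof (induction zs arbitrary: i)
  case Nil
  then show ?case by (simp add: fps_sums_0)
next
  case (Cons z zs)
  show ?case
  proof (induction i)
    case 0
    then show ?case by (simp add: fps_sums_0 fps_sums_1)
  next
    case (Suc i)
    have "fps_sums (entry_fps (Suc i)) x (x / (real (Suc i) - x))"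
      using fps_sums_geometric[of 1 x "Suc i"] assms by simp
    then show ?case
      unfolding list.map linear_gf.simps
      by (intro fps_sums_add fps_sums_mult fps_sums_1 fps_sums_const fps_sums_top Cons.IH assms)
        (use Suc Cons.prems assms in auto)
  qed
qed

text \<open>Clearing the denominators a - x turns 1 + z x / (k - x) into k - x (1 - z), whence the
  parameter \<alpha> = x (1 - z); each peak below the first contributes x^2.\<close>

lemma linear_gf_eq_numer:
  assumes "x < 1"
  shows "linear_gf (\<lambda>b. x / (real b - x)) (\<lambda>b. x\<^sup>2 / (real b * (real b - x))) zs i *
      (\<Prod>a\<in>{1..i}. real a - x) = x ^ (2 * (length zs - 1)) * numer (map (\<lambda>z. x * (1 - z)) zs) i"
proof (induction zs arbitrary: i)
  case (Cons z zs)
  show ?case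
  proof (induction i)
    case (Suc i)
    define L where "L = linear_gf (\<lambda>b. x / (real b - x)) (\<lambda>b. x\<^sup>2 / (real b * (real b - x)))"
    define P where "P = (\<Prod>a\<in>{1..i}. real a - x)"
    define k where "k = real (Suc i)"
    define M where "M zs = numer (map (\<lambda>z. x * (1 - z)) zs) i" for zs
    have k: "k - x \<noteq> 0" "k > 0" using assms by (auto simp: k_def)
    have IH1: "L (z # zs) i * P = x ^ (2 * length zs) * M (z # zs)"
      using Suc by (simp add: L_def P_def M_def)
    \<comment> \<open>\<open>length zs - 1\<close> is truncated for the empty list, where both sides
      are \<open>0\<close>.\<close>
    have IH2: "x\<^sup>2 * (L zs i * P) = x ^ (2 * length zs) * M zs"
    proof (cases zs)
      case Nil
      then show ?thesis by (simp add: L_def M_def)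
    next
      case (Cons z' zs')
      have "x\<^sup>2 * (L zs i * P) = x\<^sup>2 * (x ^ (2 * (length zs - 1)) * M zs)"
        unfolding L_def P_def M_def using Cons.IH[of i] by simp
      then show ?thesis using Cons by (simp add: power2_eq_square mult_ac)
    qed
    have "L (z # zs) (Suc i) * (P * (k - x)) =
        (k - x * (1 - z)) * (L (z # zs) i * P) + x\<^sup>2 * (L zs i * P) / k"
    proof -
      have "L (z # zs) (Suc i) = (1 + z * (x / (k - x))) * L (z # zs) i + x\<^sup>2 / (k * (k - x)) * L zs i"
        unfolding L_def k_def by (rule linear_gf.simps)
      then have "L (z # zs) (Suc i) * (k - x) = (k - x * (1 - z)) * L (z # zs) i + x\<^sup>2 * L zs i / k"
        using k by (simp add: divide_simps) (simp add: algebra_simps)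
      then have "L (z # zs) (Suc i) * (P * (k - x)) = P * ((k - x * (1 - z)) * L (z # zs) i + x\<^sup>2 * L zs i / k)"
        by (metis mult.left_commute)
      then show ?thesis by (simp add: algebra_simps)
    qed
    also have "\<dots> = x ^ (2 * length zs) * ((k - x * (1 - z)) * M (z # zs) + M zs / k)"
      unfolding IH1 IH2 by (simp add: algebra_simps)
    finally show ?case
      by (simp add: L_def P_def M_def k_def mult.commute)
  qed auto
qed simp

lemma pochhammer_eq_prod_atLeast1: "pochhammer (1 - \<beta>) m = (\<Prod>b\<in>{1..m}. real b - \<beta>)"
  by (induction m) (auto simp: pochhammer_rec' algebra_simps)

definition hook_fps :: "real \<Rightarrow> real list \<Rightarrow> nat \<Rightarrow> real fps" where
  "hook_fps y zs N = (\<Sum>i<N. top_fps (Suc i) * linear_gf entry_fps top_fps (map fps_const zs) i *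
     (\<Prod>b\<in>{1..Suc i}. resolvent_fps y b))"

text \<open>The numerators b - x of the resolvents cancel all denominators b - x of entries and
  peaks, and only the factors 1 / (b - \<beta>) with \<beta> = x (1 + y) remain. The bounds on
  \<open>x\<close> and \<open>y\<close> keep \<beta> at most 1 / 2.\<close>

lemma fps_sums_hook:
  assumes zs: "set zs \<subseteq> {0..1}" "zs \<noteq> []" and x: "0 < x" "x \<le> 1 / 4" and y: "0 \<le> y" "y \<le> 1"
  shows "fps_sums (hook_fps y zs N) x
    (x ^ (2 * length zs) * partial_gf (map (\<lambda>z. x * (1 - z)) zs) (x * (1 + y)) N)"
proof -
  define \<beta> where "\<beta> = x * (1 + y)"
  define L where "L = linear_gf (\<lambda>b. x / (real b - x)) (\<lambda>b. x\<^sup>2 / (real b * (real b - x))) zs"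
  have "x * (1 + y) \<le> 1 / 4 * 2" using x y by (intro mult_mono) auto
  then have \<beta>: "\<beta> < 1" by (simp add: \<beta>_def)
  have "fps_sums (resolvent_fps y b) x ((real b - x) / (real b - \<beta>))" if "1 \<le> b" for b
  proof -
    have b: "\<beta> < real b" using \<beta> that by simp
    have "fps_sums (resolvent_fps y b) x (1 + y * (x / (real b - x * (1 + y))))"
      unfolding resolvent_fps_def
      by (intro fps_sums_add fps_sums_mult fps_sums_1 fps_sums_const fps_sums_geometric)
        (use x y b in \<open>auto simp: \<beta>_def\<close>)
    also have "1 + y * (x / (real b - x * (1 + y))) = (real b - x) / (real b - \<beta>)"
      using b by (simp add: \<beta>_def divide_simps) (simp add: algebra_simps)
    finally show ?thesis .
  qed
  then have "fps_sums (hook_fps y zs N) x (\<Sum>i<N. x\<^sup>2 / (real (Suc i) * (real (Suc i) - x)) * L i *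
      (\<Prod>b\<in>{1..Suc i}. (real b - x) / (real b - \<beta>)))"
    unfolding hook_fps_def L_def
    by (intro fps_sums_sum fps_sums_mult fps_sums_prod fps_sums_top fps_sums_linear_gf zs) (use x in auto)
  also have "(\<Sum>i<N. x\<^sup>2 / (real (Suc i) * (real (Suc i) - x)) * L i *
      (\<Prod>b\<in>{1..Suc i}. (real b - x) / (real b - \<beta>))) =
      (\<Sum>i<N. x ^ (2 * length zs) * (numer (map (\<lambda>z. x * (1 - z)) zs) i / (real (Suc i) * pochhammer (1 - \<beta>) (Suc i))))"
  proof (intro sum.cong refl)
    fix i
    define P where "P = (\<Prod>a\<in>{1..i}. real a - x)"
    define Q where "Q = pochhammer (1 - \<beta>) (Suc i)"
    have Q: "Q > 0" unfolding Q_def using \<beta> by (intro pochhammer_pos) auto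
    have k: "real (Suc i) - x \<noteq> 0" "real (Suc i) > 0" using x by auto
    have "(\<Prod>b\<in>{1..Suc i}. (real b - x) / (real b - \<beta>)) = P * (real (Suc i) - x) / Q"
      unfolding prod_dividef Q_def pochhammer_eq_prod_atLeast1 P_def by (simp add: mult.commute)
    then have "x\<^sup>2 / (real (Suc i) * (real (Suc i) - x)) * L i * (\<Prod>b\<in>{1..Suc i}. (real b - x) / (real b - \<beta>)) =
        x\<^sup>2 * (L i * P) / (real (Suc i) * Q)"
      using k by (simp add: mult_ac)
    also have "L i * P = x ^ (2 * (length zs - 1)) * numer (map (\<lambda>z. x * (1 - z)) zs) i"
      unfolding L_def P_def using x by (intro linear_gf_eq_numer) auto
    also have "x\<^sup>2 * (x ^ (2 * (length zs - 1)) * numer (map (\<lambda>z. x * (1 - z)) zs) i) =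
        x ^ (2 * length zs) * numer (map (\<lambda>z. x * (1 - z)) zs) i"
      using zs(2) by (cases zs) (simp_all add: power2_eq_square mult_ac)
    finally show "x\<^sup>2 / (real (Suc i) * (real (Suc i) - x)) * L i * (\<Prod>b\<in>{1..Suc i}. (real b - x) / (real b - \<beta>)) =
        x ^ (2 * length zs) * (numer (map (\<lambda>z. x * (1 - z)) zs) i / (real (Suc i) * pochhammer (1 - \<beta>) (Suc i)))"
      by (simp add: Q_def)
  qed
  finally show ?thesis using zs(2) by (simp add: partial_gf_def \<beta>_def sum_distrib_left)
qed

lemma hook_fps_mono:
  assumes "set zs \<subseteq> {0..1}" "0 \<le> y"
  shows "hook_fps y zs N $ w \<le> hook_fps y zs (Suc N) $ w"
proof -
  \<comment> \<open>Here \<open>fps_sums\<close> at \<open>0\<close> serves only to carry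
    nonnegativity of coefficients through sums and products.\<close>
  have nonneg: "0 \<le> f $ k" if "fps_sums f 0 v" for f v k
    using that by (simp add: fps_sums_def)
  have "fps_sums (resolvent_fps y b) 0 (1 + y * (0 / (real b - 0 * (1 + y))))" if "1 \<le> b" for b
    unfolding resolvent_fps_def
    by (intro fps_sums_add fps_sums_mult fps_sums_1 fps_sums_const fps_sums_geometric)
      (use assms that in auto)
  then have "fps_sums (top_fps (Suc N) * linear_gf entry_fps top_fps (map fps_const zs) N *
      (\<Prod>b\<in>{1..Suc N}. resolvent_fps y b)) 0
      (0\<^sup>2 / (real (Suc N) * (real (Suc N) - 0)) *
      linear_gf (\<lambda>b. 0 / (real b - 0)) (\<lambda>b. 0\<^sup>2 / (real b * (real b - 0))) zs N *
      (\<Prod>b\<in>{1..Suc N}. 1 + y * (0 / (real b - 0 * (1 + y)))))"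
    by (intro fps_sums_mult fps_sums_prod fps_sums_top fps_sums_linear_gf assms) auto
  from nonneg[OF this] show ?thesis
    by (simp add: hook_fps_def)
qed

text \<open>Expansion of x^2 / ((m - \<beta>) (m - \<beta> + \<alpha>)) with \<beta> = x (1 + y) and
  \<alpha> = x (1 - z), since \<beta> - \<alpha> = x (y + z).\<close>

definition nest_fps :: "real \<Rightarrow> real \<Rightarrow> nat \<Rightarrow> real fps" where
  "nest_fps y z m = geometric_fps (1 + y) m * geometric_fps (y + z) m"

lemma fps_sums_chain:
  assumes "\<And>z m. z \<in> set zs \<Longrightarrow> a < m \<Longrightarrow> fps_sums (F z m) x (G z m)" "0 \<le> x"
  shows "fps_sums (chain (map F zs) a K) x (chain (map G zs) a K)"
  using assms(1)
proof (induction zs arbitrary: a)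
  case (Cons z zs)
  show ?case
    unfolding list.map chain.simps
    by (intro fps_sums_sum fps_sums_mult assms(2) Cons.IH Cons.prems) auto
qed (simp add: fps_sums_1)

lemma chain_scale: "chain (map (\<lambda>z m. k * G z m) zs) a K = k ^ length zs * chain (map G zs) a K"
  by (induction zs arbitrary: a) (simp_all add: sum_distrib_left mult_ac)

lemma fps_sums_nest:
  assumes zs: "set zs \<subseteq> {0..1}" and x: "0 < x" "x \<le> 1 / 4" and y: "0 \<le> y" "y \<le> 1"
  shows "fps_sums (chain (map (nest_fps y) zs) 0 K) x
    (x ^ (2 * length zs) * chain (kernels (x * (1 + y)) (map (\<lambda>z. x * (1 - z)) zs)) 0 K)"
proof -
  have xy: "x * (1 + y) \<le> 1 / 4 * 2" using x y by (intro mult_mono) auto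
  have "fps_sums (chain (map (nest_fps y) zs) 0 K) x (chain (map (\<lambda>z m. x\<^sup>2 *
      (1 / ((real m - x * (1 + y)) * (real m - x * (1 + y) + x * (1 - z))))) zs) 0 K)"
  proof (rule fps_sums_chain)
    fix z and m :: nat assume "z \<in> set zs" "0 < m"
    then have z: "0 \<le> z" "z \<le> 1" and m: "1 \<le> real m" using zs by auto
    have "x * (y + z) \<le> 1 / 4 * 2" using x y z by (intro mult_mono) auto
    then have "fps_sums (nest_fps y z m) x (x / (real m - x * (1 + y)) * (x / (real m - x * (y + z))))"
      unfolding nest_fps_def by (intro fps_sums_mult fps_sums_geometric) (use x y z m xy in auto)
    also have "x / (real m - x * (1 + y)) * (x / (real m - x * (y + z))) =
        x\<^sup>2 * (1 / ((real m - x * (1 + y)) * (real m - x * (1 + y) + x * (1 - z))))"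
      by (simp add: power2_eq_square algebra_simps)
    finally show "fps_sums (nest_fps y z m) x
        (x\<^sup>2 * (1 / ((real m - x * (1 + y)) * (real m - x * (1 + y) + x * (1 - z)))))" .
  qed (use x in auto)
  then show ?thesis
    unfolding chain_scale by (simp add: kernels_def power_mult comp_def)
qed

lemma nest_chain_mono:
  assumes "set zs \<subseteq> {0..1}" "0 \<le> y"
  shows "chain (map (nest_fps y) zs) a K $ w \<le> chain (map (nest_fps y) zs) a (Suc K) $ w"
  using assms(1)
proof (induction zs arbitrary: a w)
  case (Cons z zs)
  have nn: "0 \<le> nest_fps y u m $ i" if "u \<in> set (z # zs)" for u m i
    using Cons.prems that assms(2)
    by (auto simp: nest_fps_def fps_mult_nth geometric_fps_def intro!: sum_nonneg)
  have nonneg: "0 \<le> chain (map (nest_fps y) zs) m K' $ i" for m K' i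
  proof -
    have "\<forall>zs'. set zs' \<subseteq> set (z # zs) \<longrightarrow> (\<forall>m i. 0 \<le> chain (map (nest_fps y) zs') m K' $ i)"
    proof
      fix zs' show "set zs' \<subseteq> set (z # zs) \<longrightarrow> (\<forall>m i. 0 \<le> chain (map (nest_fps y) zs') m K' $ i)"
        by (induction zs') (auto simp: fps_sum_nth fps_mult_nth[of "nest_fps y _ _"] intro!: sum_nonneg mult_nonneg_nonneg nn)
    qed
    then show ?thesis by (meson set_subset_Cons)
  qed
  have "chain (map (nest_fps y) (z # zs)) a K $ w \<le>
      (\<Sum>m\<in>{a<..K}. (nest_fps y z m * chain (map (nest_fps y) zs) m (Suc K)) $ w)"
    unfolding list.map chain.simps fps_sum_nth fps_mult_nth[of "nest_fps y _ _"]
    by (intro sum_mono mult_left_mono Cons.IH nn) (use Cons.prems in auto)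
  also have "\<dots> \<le> chain (map (nest_fps y) (z # zs)) a (Suc K) $ w"
    unfolding list.map chain.simps fps_sum_nth
    by (intro sum_mono2) (auto simp: fps_mult_nth intro!: sum_nonneg mult_nonneg_nonneg nn nonneg)
  finally show ?case .
qed simp

section \<open>Coefficientwise limits\<close>

lemma power_series_eq_0:
  fixes a :: "nat \<Rightarrow> real"
  assumes "0 < \<epsilon>" and "\<And>x. 0 < x \<Longrightarrow> x \<le> \<epsilon> \<Longrightarrow> (\<lambda>k. a k * x ^ k) sums 0"
  shows "a w = 0"
proof (induction w rule: less_induct)
  case (less w)
  \<comment> \<open>The coefficients before \<open>w\<close> vanish by induction, so dividing by x^w
    makes \<open>a w\<close> the constant term. Only positive arguments are given, hence the limit
    at \<open>0\<close> from the right.\<close>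
  define b where "b k = a (k + w)" for k
  have shift: "(\<lambda>k. b k * x ^ k) sums 0" if "0 < x" "x \<le> \<epsilon>" for x
  proof -
    have "(\<lambda>k. a (k + w) * x ^ (k + w)) sums (0 - (\<Sum>k<w. a k * x ^ k))"
      using assms(2)[OF that] by (rule sums_split_initial_segment)
    then have "(\<lambda>k. 1 / x ^ w * (a (k + w) * x ^ (k + w))) sums (1 / x ^ w * 0)"
      by (intro sums_mult) (simp add: less.IH)
    then show ?thesis using that by (simp add: b_def power_add mult_ac)
  qed
  define f where "f x = (\<Sum>k. b k * x ^ k)" for x
  have "(f \<longlongrightarrow> b 0) (at 0)"
  proof (rule powser_limit_0_strong[OF assms(1)])
    fix x :: real assume "x \<noteq> 0" "norm x < \<epsilon>"
    then have "summable (\<lambda>k. b k * x ^ k)"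
      using powser_inside[OF sums_summable[OF shift[of \<epsilon>]], of x] assms(1) by simp
    then show "(\<lambda>k. b k * x ^ k) sums f x"
      unfolding f_def by (rule summable_sums)
  qed
  then have "(f \<longlongrightarrow> b 0) (at_right 0)"
    by (rule tendsto_mono[OF at_le[OF subset_UNIV]])
  moreover have "eventually (\<lambda>x. f x = 0) (at_right 0)"
    unfolding f_def eventually_at_right_field
    by (intro exI[of _ \<epsilon>]) (use assms(1) shift in \<open>auto simp: sums_iff\<close>)
  then have "(f \<longlongrightarrow> 0) (at_right 0)"
    by (rule tendsto_eventually)
  ultimately have "b 0 = 0"
    by (intro tendsto_unique[of "at_right (0 :: real)" f]) auto
  then show ?case by (simp add: b_def)
qed

text \<open>Monotone convergence: the coefficients are nonnegative and increase with
  \<open>N\<close>, and the value at \<epsilon> bounds them. The limit series is at most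
  \<open>L x\<close> by its finite partial sums and at least \<open>L x\<close> because it dominates
  every \<open>S x N\<close>.\<close>

lemma coeff_limits:
  fixes f :: "nat \<Rightarrow> real fps"
  assumes "0 < \<epsilon>" and mono: "\<And>N w. f N $ w \<le> f (Suc N) $ w"
    and sums: "\<And>x N. 0 < x \<Longrightarrow> x \<le> \<epsilon> \<Longrightarrow> fps_sums (f N) x (S x N)"
    and lim: "\<And>x. 0 < x \<Longrightarrow> x \<le> \<epsilon> \<Longrightarrow> S x \<longlonglongrightarrow> L x"
  shows "\<exists>c. (\<forall>w. (\<lambda>N. f N $ w) \<longlonglongrightarrow> c w) \<and> (\<forall>x. 0 < x \<longrightarrow> x \<le> \<epsilon> \<longrightarrow> (\<lambda>w. c w * x ^ w) sums L x)"
proof -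
  have nonneg: "0 \<le> f N $ w" for N w
    using sums[OF assms(1) order_refl, of N] by (simp add: fps_sums_def)
  have S_le: "S x N \<le> L x" if x: "0 < x" "x \<le> \<epsilon>" for x N
  proof -
    have "incseq (S x)"
    proof (rule incseq_SucI)
      fix N
      show "S x N \<le> S x (Suc N)"
        by (rule sums_le[of "\<lambda>w. f N $ w * x ^ w" "\<lambda>w. f (Suc N) $ w * x ^ w"])
          (use sums[OF x] x mono in \<open>auto simp: fps_sums_def intro!: mult_right_mono\<close>)
    qed
    then show ?thesis using lim[OF x] by (rule incseq_le)
  qed
  have partial: "(\<Sum>w<W. f N $ w * x ^ w) \<le> L x" if x: "0 < x" "x \<le> \<epsilon>" for x N W
  proof -
    have "(\<Sum>w<W. f N $ w * x ^ w) \<le> S x N"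
    proof -
      have "(\<lambda>w. f N $ w * x ^ w) sums S x N" using sums[OF x] by (simp add: fps_sums_def)
      moreover from this have "(\<Sum>w<W. f N $ w * x ^ w) \<le> (\<Sum>w. f N $ w * x ^ w)"
        using nonneg x by (intro sum_le_suminf) (auto simp: sums_iff)
      ultimately show ?thesis by (simp add: sums_iff)
    qed
    then show ?thesis using S_le[OF x, of N] by linarith
  qed
  have "\<exists>c. (\<lambda>N. f N $ w) \<longlonglongrightarrow> c" for w
  proof -
    have "f N $ w \<le> L \<epsilon> / \<epsilon> ^ w" for N
    proof -
      have "f N $ w * \<epsilon> ^ w \<le> (\<Sum>v<Suc w. f N $ v * \<epsilon> ^ v)"
        by (rule member_le_sum[of w "{..<Suc w}" "\<lambda>v. f N $ v * \<epsilon> ^ v"]) (use nonneg assms(1) in auto)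
      also have "\<dots> \<le> L \<epsilon>" by (rule partial) (use assms(1) in auto)
      finally show ?thesis using assms(1) by (simp add: field_simps)
    qed
    then have "Bseq (\<lambda>N. f N $ w)"
      by (intro BseqI'[of _ "L \<epsilon> / \<epsilon> ^ w"]) (simp add: nonneg)
    moreover have "monoseq (\<lambda>N. f N $ w)" using mono by (auto simp: monoseq_Suc)
    ultimately show ?thesis using Bseq_monoseq_convergent by (auto simp: convergent_def)
  qed
  then obtain c where c: "\<And>w. (\<lambda>N. f N $ w) \<longlonglongrightarrow> c w" by metis
  have c_ge: "f N $ w \<le> c w" for N w
    by (rule incseq_le[OF incseq_SucI c]) (rule mono)
  have c_nonneg: "0 \<le> c w" for w
    using nonneg[of 0 w] c_ge[of 0 w] by linarith
  have "(\<lambda>w. c w * x ^ w) sums L x" if x: "0 < x" "x \<le> \<epsilon>" for x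
  proof -
    have le: "(\<Sum>w<W. c w * x ^ w) \<le> L x" for W
    proof (rule LIMSEQ_le_const2)
      show "(\<lambda>N. \<Sum>w<W. f N $ w * x ^ w) \<longlonglongrightarrow> (\<Sum>w<W. c w * x ^ w)"
        by (intro tendsto_sum tendsto_mult c tendsto_const)
    qed (use partial[OF x] in auto)
    have summ: "summable (\<lambda>w. c w * x ^ w)"
      by (rule summableI_nonneg_bounded[of _ "L x"]) (use le c_nonneg x in auto)
    have "S x N \<le> (\<Sum>w. c w * x ^ w)" for N
      by (rule sums_le[of "\<lambda>w. f N $ w * x ^ w" "\<lambda>w. c w * x ^ w"])
        (use sums[OF x] x c_ge summ in \<open>auto simp: fps_sums_def summable_sums intro!: mult_right_mono\<close>)
    then have "L x \<le> (\<Sum>w. c w * x ^ w)"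
      by (intro LIMSEQ_le_const2[OF lim[OF x]]) auto
    moreover have "(\<Sum>w. c w * x ^ w) \<le> L x"
      by (rule suminf_le_const[OF summ le])
    ultimately show ?thesis using summable_sums[OF summ] by simp
  qed
  with c show ?thesis by blast
qed

text \<open>Both families take values with the same limit for \<open>0 < x \<le> 1 / 4\<close>, so
  by uniqueness of power series their coefficients have the same limits.\<close>

lemma hook_nest_limits:
  assumes zs: "set zs \<subseteq> {0..1}" "zs \<noteq> []" and y: "0 \<le> y" "y \<le> 1"
    and "(\<lambda>K. chain (map (nest_fps y) zs) 0 K $ w) \<longlonglongrightarrow> v"
  shows "(\<lambda>N. hook_fps y zs N $ w) \<longlonglongrightarrow> v"
proof -
  define L where "L x = x ^ (2 * length zs) *
    lim (chain (kernels (x * (1 + y)) (map (\<lambda>z. x * (1 - z)) zs)) 0)" for x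
  have params: "set (map (\<lambda>z. x * (1 - z)) zs) \<subseteq> {0..1} \<and> 0 \<le> x * (1 + y) \<and> x * (1 + y) < 1"
    if "0 < x" "x \<le> 1 / 4" for x :: real
  proof -
    have "x * (1 + y) \<le> 1 / 4 * 2" using that y by (intro mult_mono) auto
    moreover have "x * (1 - z) \<le> 1" if "z \<in> set zs" for z
      using that zs \<open>0 < x\<close> \<open>x \<le> 1 / 4\<close> by (intro mult_le_one) auto
    ultimately show ?thesis using that zs y by auto
  qed
  have "\<exists>c. (\<forall>w. (\<lambda>N. hook_fps y zs N $ w) \<longlonglongrightarrow> c w) \<and>
      (\<forall>x. 0 < x \<longrightarrow> x \<le> 1 / 4 \<longrightarrow> (\<lambda>w. c w * x ^ w) sums L x)"
  proof (rule coeff_limits)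
    show "(\<lambda>N. x ^ (2 * length zs) * partial_gf (map (\<lambda>z. x * (1 - z)) zs) (x * (1 + y)) N) \<longlonglongrightarrow> L x"
      if "0 < x" "x \<le> 1 / 4" for x
      unfolding L_def using params[OF that] by (intro tendsto_mult_left partial_gf_tendsto) auto
  qed (use assms in \<open>auto intro!: fps_sums_hook hook_fps_mono\<close>)
  then obtain c where c: "\<And>w. (\<lambda>N. hook_fps y zs N $ w) \<longlonglongrightarrow> c w"
    "\<And>x. 0 < x \<Longrightarrow> x \<le> 1 / 4 \<Longrightarrow> (\<lambda>w. c w * x ^ w) sums L x" by blast
  have "\<exists>c. (\<forall>w. (\<lambda>N. chain (map (nest_fps y) zs) 0 N $ w) \<longlonglongrightarrow> c w) \<and>
      (\<forall>x. 0 < x \<longrightarrow> x \<le> 1 / 4 \<longrightarrow> (\<lambda>w. c w * x ^ w) sums L x)"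
  proof (rule coeff_limits)
    show "(\<lambda>N. x ^ (2 * length zs) * chain (kernels (x * (1 + y)) (map (\<lambda>z. x * (1 - z)) zs)) 0 N) \<longlonglongrightarrow> L x"
      if "0 < x" "x \<le> 1 / 4" for x
      unfolding L_def using params[OF that] kernel_chain_convergent
      by (intro tendsto_mult_left) (auto simp: convergent_LIMSEQ_iff)
  qed (use assms in \<open>auto intro!: fps_sums_nest nest_chain_mono\<close>)
  then obtain d where d: "\<And>w. (\<lambda>N. chain (map (nest_fps y) zs) 0 N $ w) \<longlonglongrightarrow> d w"
    "\<And>x. 0 < x \<Longrightarrow> x \<le> 1 / 4 \<Longrightarrow> (\<lambda>w. d w * x ^ w) sums L x" by blast
  have "c w - d w = 0"
  proof (rule power_series_eq_0[of "1 / 4" "\<lambda>w. c w - d w"])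
    fix x :: real assume "0 < x" "x \<le> 1 / 4"
    from sums_diff[OF c(2)[OF this] d(2)[OF this]]
    show "(\<lambda>k. (c k - d k) * x ^ k) sums 0" by (simp add: left_diff_distrib)
  qed simp
  then show ?thesis using c(1)[of w] LIMSEQ_unique[OF d(1)[of w] assms(5)] by simp
qed

section \<open>Rationality of the coefficients of the nested sums\<close>

inductive_set chain_span :: "nat \<Rightarrow> nat \<Rightarrow> (nat \<Rightarrow> nat \<Rightarrow> real) set" for n w where
  zero: "(\<lambda>a K. 0) \<in> chain_span n w"
| add: "u \<in> chain_span n w \<Longrightarrow> k \<in> big_indices n w \<Longrightarrow>
    (\<lambda>a K. of_rat q * chain (recip_powers k) a K + u a K) \<in> chain_span n w"

lemma chain_span_add:
  "u \<in> chain_span n w \<Longrightarrow> v \<in> chain_span n w \<Longrightarrow> (\<lambda>a K. u a K + v a K) \<in> chain_span n w"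
  by (induction rule: chain_span.induct) (auto simp: add.assoc intro: chain_span.add)

lemma chain_span_sum:
  "(\<And>i. i \<in> I \<Longrightarrow> f i \<in> chain_span n w) \<Longrightarrow> (\<lambda>a K. \<Sum>i\<in>I. f i a K) \<in> chain_span n w"
  by (induction I rule: infinite_finite_induct) (auto intro: chain_span_add chain_span.zero)

text \<open>Elements of \<open>chain_span\<close> are functions of both bounds because prepending an
  entry sums over the lower bound \<open>m\<close> of the old chain.\<close>

lemma chain_span_prepend:
  assumes "u \<in> chain_span n w" "2 \<le> i"
  shows "(\<lambda>a K. \<Sum>m\<in>{a<..K}. of_rat q / real m ^ i * u m K) \<in> chain_span (Suc n) (i + w)"
  using assms(1)
proof (induction rule: chain_span.induct)
  case zero
  then show ?case by (simp add: chain_span.zero)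
next
  case (add u k q')
  have "i # k \<in> big_indices (Suc n) (i + w)"
    using add.hyps(2) assms(2) by (auto simp: big_indices_def)
  from chain_span.add[OF add.IH this, of "q * q'"] show ?case
    by (simp add: of_rat_mult sum_distrib_left distrib_left sum.distrib mult_ac)
qed

lemma chain_span_limit: "u \<in> chain_span n w \<Longrightarrow> (\<lambda>K. u 0 K) \<in> lim_span n w"
proof (induction rule: chain_span.induct)
  case zero
  then show ?case by (auto simp: lim_span_def mzv_span_0)
next
  case (add u k q)
  have "(\<lambda>K. chain (recip_powers k) 0 K) \<in> lim_span n w"
    using mzv_chain_limit[of k] mzv_in_span[OF add.hyps(2)] add.hyps(2)
    by (auto simp: lim_span_def big_indices_def)
  then show ?case by (intro lim_span_add lim_span_scale add.IH)
qed

text \<open>Every pair of terms of the two expansions contributes the same power of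
  \<open>m\<close>, so for rational parameters the coefficient is a rational number over
  m^k.\<close>

lemma nest_fps_nth:
  assumes "0 < m"
  shows "nest_fps (of_rat y) (of_rat z) m $ k =
    of_rat (\<Sum>i\<in>{1..<k}. (1 + y) ^ (i - 1) * (y + z) ^ (k - i - 1)) / real m ^ k"
proof -
  have "nest_fps (of_rat y) (of_rat z) m $ k =
      (\<Sum>i\<in>{1..<k}. (1 + of_rat y) ^ (i - 1) * (of_rat y + of_rat z) ^ (k - i - 1) / real m ^ k)"
    unfolding nest_fps_def fps_mult_nth
    by (rule sum.mono_neutral_cong_right)
      (auto simp: geometric_fps_def divide_simps not_less_eq_eq le_eq_less_or_eq simp flip: power_add)
  then show ?thesis
    by (simp add: of_rat_sum of_rat_mult of_rat_power of_rat_add sum_divide_distrib)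
qed

lemma nest_chain_in_span:
  "(\<lambda>a K. chain (map (\<lambda>z. nest_fps (of_rat y) (of_rat z)) zs) a K $ w) \<in> chain_span (length zs) w"
proof (induction zs arbitrary: w)
  case Nil
  show ?case
  proof (cases "w = 0")
    case True
    have "[] \<in> big_indices 0 0" by (simp add: big_indices_def)
    from chain_span.add[OF chain_span.zero this, of 1] True show ?thesis by simp
  qed (simp add: chain_span.zero)
next
  case (Cons z zs)
  define u where "u w a K = chain (map (\<lambda>z. nest_fps (of_rat y) (of_rat z)) zs) a K $ w" for w a K
  define q where "q k = (\<Sum>i\<in>{1..<k}. (1 + y) ^ (i - 1) * (y + z) ^ (k - i - 1))" for k
  have q0: "q k = 0" if "k < 2" for k using that by (simp add: q_def)
  have "(\<lambda>a K. \<Sum>k\<in>{2..w}. \<Sum>m\<in>{a<..K}. of_rat (q k) / real m ^ k * u (w - k) m K)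
      \<in> chain_span (length (z # zs)) w"
  proof (rule chain_span_sum)
    fix k assume "k \<in> {2..w}"
    moreover have "u (w - k) \<in> chain_span (length zs) (w - k)"
      using Cons.IH[of "w - k"] unfolding u_def[abs_def] .
    ultimately show "(\<lambda>a K. \<Sum>m\<in>{a<..K}. of_rat (q k) / real m ^ k * u (w - k) m K) \<in> chain_span (length (z # zs)) w"
      using chain_span_prepend[of "u (w - k)" "length zs" "w - k" k "q k"] by simp
  qed
  moreover have "chain (map (\<lambda>z. nest_fps (of_rat y) (of_rat z)) (z # zs)) a K $ w =
      (\<Sum>k\<in>{2..w}. \<Sum>m\<in>{a<..K}. of_rat (q k) / real m ^ k * u (w - k) m K)" for a K
  proof -
    have "chain (map (\<lambda>z. nest_fps (of_rat y) (of_rat z)) (z # zs)) a K $ w =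
        (\<Sum>m\<in>{a<..K}. \<Sum>k\<in>{0..w}. of_rat (q k) / real m ^ k * u (w - k) m K)"
      by (simp add: fps_sum_nth fps_mult_nth nest_fps_nth q_def u_def)
    also have "\<dots> = (\<Sum>k\<in>{0..w}. \<Sum>m\<in>{a<..K}. of_rat (q k) / real m ^ k * u (w - k) m K)"
      by (rule sum.swap)
    also have "\<dots> = (\<Sum>k\<in>{2..w}. \<Sum>m\<in>{a<..K}. of_rat (q k) / real m ^ k * u (w - k) m K)"
      by (rule sum.mono_neutral_right) (auto simp: q0)
    finally show ?thesis .
  qed
  ultimately show ?case by simp
qed

lemma hook_in_lim_span:
  assumes "set zs \<subseteq> {0..1}" "zs \<noteq> []" "0 \<le> y" "y \<le> 1"
  shows "(\<lambda>N. hook_fps (of_rat y) (map of_rat zs) N $ w) \<in> lim_span (length zs) w"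
proof -
  obtain v where v: "v \<in> mzv_span (length zs) w"
    "(\<lambda>K. chain (map (\<lambda>z. nest_fps (of_rat y) (of_rat z)) zs) 0 K $ w) \<longlonglongrightarrow> v"
    using chain_span_limit[OF nest_chain_in_span[of y zs w]] by (auto simp: lim_span_def)
  have "(\<lambda>N. hook_fps (of_rat y) (map of_rat zs) N $ w) \<longlonglongrightarrow> v"
    using v(2) assms by (intro hook_nest_limits) (auto simp: comp_def)
  with v(1) show ?thesis by (auto simp: lim_span_def)
qed

section \<open>Zigzag sums with limit in the span\<close>

lemma monomial_fps_const: "monomial (map fps_const zs) e = fps_const (monomial zs e)"
  by (induction zs e rule: monomial.induct)
    (simp_all add: fps_const_power flip: fps_const_mult)

text \<open>The truncated generating function is a polynomial in \<open>y\<close> and the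
  \<open>z\<close> parameters whose values at rational points of the unit cube lie in
  \<open>lim_span\<close>; interpolation yields the single coefficients.\<close>

lemma hook_ribbon_in_lim_span:
  "(\<lambda>N. ribbon N entry_fps top_fps ((s, p) # map (Pair 0) ps) (Suc N) $ w) \<in> lim_span (Suc (length ps)) w"
proof -
  \<comment> \<open>Large enough for the coefficient of x^w to be unaffected by the cutoff and for
    all exponents to lie in \<open>exps B d\<close>.\<close>
  define B where "B = w + s + p + sum_list ps"
  define d where "d = Suc (Suc (length ps))"
  have "(\<lambda>N. ribbon N entry_fps top_fps (hook_rows (s # p # ps)) (Suc N) $ w) \<in> lim_span (Suc (length ps)) w"
  proof (rule multi_poly_coeffs_in_lim_span[where B = B and d = d and
        c = "\<lambda>e N. ribbon N entry_fps top_fps (hook_rows e) (Suc N) $ w"])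
    show "s # p # ps \<in> exps B d"
      by (auto simp: exps_def B_def d_def dest!: member_le_sum_list)
    fix ts :: "rat list" assume "length ts = d" and ts: "set ts \<subseteq> {0..1}"
    then obtain y z zs where ts_eq: "ts = y # z # zs" and len: "length zs = length ps"
      by (auto simp: d_def length_Suc_conv)
    have "(\<Sum>e\<in>exps B d. monomial (map of_rat ts) e * ribbon N entry_fps top_fps (hook_rows e) (Suc N) $ w) =
        hook_fps (of_rat y) (map of_rat (z # zs)) N $ w" for N
    proof -
      have "fps_cong B
          (\<Sum>e\<in>exps B d. monomial (map fps_const (map of_rat ts)) e * ribbon N entry_fps top_fps (hook_rows e) (Suc N))
          (hook_fps (of_rat y) (map of_rat (z # zs)) N)"
        using hook_gf_cong[where e = entry_fps and t = top_fps and q = "resolvent_fps (of_rat y)" and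
            y = "fps_const (of_rat y)" and z = "fps_const (of_rat z)" and B = B and N = N and
            zs = "map fps_const (map of_rat zs)"]
          resolvent_fps_eq[of _ "of_rat y"]
        by (simp add: hook_fps_def ts_eq d_def len)
      then show ?thesis
        unfolding monomial_fps_const fps_cong_def by (auto simp: fps_sum_nth B_def)
    qed
    then show "(\<lambda>N. \<Sum>e\<in>exps B d. monomial (map of_rat ts) e * ribbon N entry_fps top_fps (hook_rows e) (Suc N) $ w)
        \<in> lim_span (Suc (length ps)) w"
      using hook_in_lim_span[of "z # zs" y w] ts by (simp add: ts_eq len)
  qed
  then show ?thesis by simp
qed

text \<open>Lexicographic induction on the number of rows and then on the total ascent length of all
  rows but the first. Once that is \<open>0\<close> the ribbon is a hook; otherwise a cut before a
  later ascending row expresses it through a product of two shorter ribbons and a ribbon with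
  smaller ascent length.\<close>

lemma ribbon_in_lim_span:
  "rs \<noteq> [] \<Longrightarrow> (\<lambda>N. ribbon N entry_fps top_fps rs (Suc N) $ w) \<in> lim_span (length rs) w"
proof (induction "(length rs, sum_list (map fst (tl rs)))" arbitrary: rs w
    rule: wf_induct_rule[OF wf_lex_prod[OF wf_less_than wf_less_than]])
  case 1
  show ?case
  proof (cases "\<forall>r\<in>set (tl rs). fst r = 0")
    case True
    obtain s p rs' where rs: "rs = (s, p) # rs'" using 1(2) by (cases rs) auto
    have "rs' = map (Pair 0) (map snd rs')"
      using True rs by (induction rs' arbitrary: rs) auto
    then show ?thesis
      using hook_ribbon_in_lim_span[of s p "map snd rs'" w] rs by simp
  next
    case False
    then obtain r where r: "r \<in> set (tl rs)" "fst r \<noteq> 0" by blast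
    then obtain s' p' where r_eq: "r = (Suc s', p')" by (metis not0_implies_Suc prod.collapse)
    obtain xs post where "tl rs = xs @ r # post" using r(1) by (meson split_list)
    then obtain x where "rs = (x # xs) @ r # post"
      using 1(2) by (metis append_Cons list.collapse)
    moreover obtain pre s p where "x # xs = pre @ [(s, p)]"
      by (metis append_butlast_last_id list.discI prod.collapse)
    ultimately have rs: "rs = pre @ (s, p) # (Suc s', p') # post" by (simp add: r_eq)
    define R where "R rs N = ribbon N entry_fps top_fps rs (Suc N)" for rs N
    have tl_pre: "sum_list (map fst (tl (pre @ (s, Suc p) # (s', p') # post))) < sum_list (map fst (tl rs))"
      unfolding rs by (cases pre) auto
    have 2: "(\<lambda>N. R (pre @ (s, Suc p) # (s', p') # post) N $ w) \<in> lim_span (length rs) w"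
      unfolding R_def using 1(1)[of "pre @ (s, Suc p) # (s', p') # post" w] tl_pre by (simp add: rs)
    have A: "(\<lambda>N. R (pre @ [(s, Suc p)]) N $ v) \<in> lim_span (Suc (length pre)) v" for v
      unfolding R_def using 1(1)[of "pre @ [(s, Suc p)]" v] by (simp add: rs)
    have B: "(\<lambda>N. R ((s', p') # post) N $ v) \<in> lim_span (Suc (length post)) v" for v
      unfolding R_def using 1(1)[of "(s', p') # post" v] by (simp add: rs)
    have "(\<lambda>N. \<Sum>i\<in>{0..w}. R (pre @ [(s, Suc p)]) N $ i * R ((s', p') # post) N $ (w - i)) \<in> lim_span (length rs) w"
    proof (rule lim_span_sum)
      fix i assume "i \<in> {0..w}"
      then show "(\<lambda>N. R (pre @ [(s, Suc p)]) N $ i * R ((s', p') # post) N $ (w - i)) \<in> lim_span (length rs) w"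
        using lim_span_mult[OF A[of i] B[of "w - i"]] by (simp add: rs)
    qed
    then have "(\<lambda>N. (R (pre @ [(s, Suc p)]) N * R ((s', p') # post) N) $ w -
        R (pre @ (s, Suc p) # (s', p') # post) N $ w) \<in> lim_span (length rs) w"
      unfolding fps_mult_nth by (intro lim_span_diff 2)
    moreover have "(R (pre @ [(s, Suc p)]) N * R ((s', p') # post) N) $ w -
        R (pre @ (s, Suc p) # (s', p') # post) N $ w = R rs N $ w" for N
      unfolding R_def rs ribbon_cut[symmetric] by simp
    ultimately show ?thesis by (simp add: R_def)
  qed
qed

section \<open>Zigzag sums as truncations of the original sums\<close>

text \<open>Generating function of a weighted class; finiteness of each fibre is included because
  \<open>sum\<close> over an infinite set is \<open>0\<close>.\<close>

definition enumerates :: "('b \<Rightarrow> bool) \<Rightarrow> ('b \<Rightarrow> nat) \<Rightarrow> ('b \<Rightarrow> real) \<Rightarrow> real fps \<Rightarrow> bool" where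
  "enumerates P wt p f \<longleftrightarrow>
     (\<forall>u. finite {x. P x \<and> wt x = u} \<and> f $ u = (\<Sum>x | P x \<and> wt x = u. p x))"

lemma enumerates_mult:
  assumes "enumerates P wx p f" "enumerates Q wy q g"
  shows "enumerates (\<lambda>(x, y). P x \<and> Q y) (\<lambda>(x, y). wx x + wy y) (\<lambda>(x, y). p x * q y) (f * g)"
  unfolding enumerates_def
proof (intro allI conjI)
  fix w
  define X where "X u = {x. P x \<and> wx x = u}" for u
  define Y where "Y u = {y. Q y \<and> wy y = u}" for u
  have fin: "finite (X u)" "finite (Y u)" and f: "f $ u = sum p (X u)" and g: "g $ u = sum q (Y u)" for u
    using assms by (auto simp: enumerates_def X_def Y_def)
  have set_eq: "{z. (case z of (x, y) \<Rightarrow> P x \<and> Q y) \<and> (case z of (x, y) \<Rightarrow> wx x + wy y) = w} =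
      (\<Union>i\<in>{0..w}. X i \<times> Y (w - i))"
    by (force simp: X_def Y_def)
  show "finite {z. (case z of (x, y) \<Rightarrow> P x \<and> Q y) \<and> (case z of (x, y) \<Rightarrow> wx x + wy y) = w}"
    unfolding set_eq using fin by auto
  have "(f * g) $ w = (\<Sum>i\<in>{0..w}. \<Sum>(x, y)\<in>X i \<times> Y (w - i). p x * q y)"
    by (simp add: fps_mult_nth f g sum_product sum.cartesian_product)
  also have "\<dots> = (\<Sum>z\<in>(\<Union>i\<in>{0..w}. X i \<times> Y (w - i)). case z of (x, y) \<Rightarrow> p x * q y)"
    by (rule sum.UNION_disjoint[symmetric]) (use fin in \<open>auto simp: X_def Y_def\<close>)
  finally show "(f * g) $ w = (\<Sum>z | (case z of (x, y) \<Rightarrow> P x \<and> Q y) \<and> (case z of (x, y) \<Rightarrow> wx x + wy y) = w.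
      case z of (x, y) \<Rightarrow> p x * q y)"
    unfolding set_eq .
qed

lemma enumerates_reindex:
  assumes "enumerates P wt p f"
    and "\<And>x. P x \<Longrightarrow> P' (\<phi> x) \<and> \<psi> (\<phi> x) = x"
    and "\<And>y. P' y \<Longrightarrow> P (\<psi> y) \<and> \<phi> (\<psi> y) = y \<and> wt (\<psi> y) = wt' y \<and> p (\<psi> y) = p' y"
  shows "enumerates P' wt' p' f"
  unfolding enumerates_def
proof (intro allI conjI)
  fix u
  have "{y. P' y \<and> wt' y = u} \<subseteq> \<phi> ` {x. P x \<and> wt x = u}"
  proof
    fix y assume "y \<in> {y. P' y \<and> wt' y = u}"
    then show "y \<in> \<phi> ` {x. P x \<and> wt x = u}"
      using assms(3)[of y] by (intro image_eqI[of _ _ "\<psi> y"]) auto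
  qed
  then show "finite {y. P' y \<and> wt' y = u}"
    by (rule finite_subset) (use assms(1) in \<open>simp add: enumerates_def\<close>)
  have "f $ u = (\<Sum>x | P x \<and> wt x = u. p x)"
    using assms(1) by (simp add: enumerates_def)
  also have "\<dots> = (\<Sum>y | P' y \<and> wt' y = u. p' y)"
  proof (rule sum.reindex_bij_witness[of _ \<psi> \<phi>])
    fix x assume "x \<in> {x. P x \<and> wt x = u}"
    then have x: "P x" "wt x = u" by auto
    then have "P' (\<phi> x)" "\<psi> (\<phi> x) = x" using assms(2) by auto
    with assms(3)[of "\<phi> x"] x show "\<psi> (\<phi> x) = x" "\<phi> x \<in> {y. P' y \<and> wt' y = u}" "p' (\<phi> x) = p x" by auto
  qed (use assms(3) in auto)
  finally show "f $ u = (\<Sum>y | P' y \<and> wt' y = u. p' y)" .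
qed

lemma enumerates_singleton:
  assumes "\<And>x. P x \<longleftrightarrow> x = x0" "wt x0 = 0" "p x0 = 1"
  shows "enumerates P wt p 1"
  unfolding enumerates_def
proof (intro allI conjI)
  fix u
  have "{x. P x \<and> wt x = u} = (if u = 0 then {x0} else {})" using assms by auto
  then show "finite {x. P x \<and> wt x = u}" "1 $ u = (\<Sum>x | P x \<and> wt x = u. p x)"
    using assms(3) by auto
qed

lemma enumerates_entry: "enumerates (\<lambda>k. 0 < k) (\<lambda>k. k) (\<lambda>k. 1 / real x ^ k) (entry_fps x)"
  unfolding enumerates_def
proof (intro allI conjI)
  fix u :: nat
  have "{k. 0 < k \<and> k = u} = (if u = 0 then {} else {u})" by auto
  then show "finite {k. 0 < k \<and> k = u}" "entry_fps x $ u = (\<Sum>k | 0 < k \<and> k = u. 1 / real x ^ k)"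
    by (auto simp: geometric_fps_def)
qed

lemma enumerates_top: "enumerates (\<lambda>k. 2 \<le> k) (\<lambda>k. k) (\<lambda>k. 1 / real x ^ k) (top_fps x)"
  unfolding enumerates_def
proof (intro allI conjI)
  fix u :: nat
  have "{k. 2 \<le> k \<and> k = u} = (if u < 2 then {} else {u})" by auto
  then show "finite {k. 2 \<le> k \<and> k = u}" "top_fps x $ u = (\<Sum>k | 2 \<le> k \<and> k = u. 1 / real x ^ k)"
    by (auto simp: top_fps_def)
qed

section \<open>Generating functions over index arrays\<close>

definition power_prod :: "nat list \<Rightarrow> nat list \<Rightarrow> real" where
  "power_prod xs k = (\<Prod>j<length k. real (xs ! j) ^ (k ! j))"

lemma power_prod_Nil [simp]: "power_prod xs [] = 1"
  by (simp add: power_prod_def)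

lemma power_prod_Cons [simp]: "power_prod (x # xs) (i # k) = real x ^ i * power_prod xs k"
  unfolding power_prod_def by (subst prod.lessThan_Suc_shift length_Cons)+ simp

lemma enumerates_entries:
  "enumerates (\<lambda>l. is_index l \<and> length l = length xs) sum_list (\<lambda>l. 1 / power_prod xs l)
     (prod_list (map entry_fps xs))"
proof (induction xs)
  case Nil
  have "enumerates (\<lambda>l. is_index l \<and> length l = length []) sum_list (\<lambda>l. 1 / power_prod [] l) 1"
    by (rule enumerates_singleton[of _ "[]"]) (auto simp: is_index_def)
  then show ?case by simp
next
  case (Cons x xs)
  show ?case
    unfolding list.map prod_list.Cons
    by (rule enumerates_reindex[where \<phi> = "\<lambda>(i, l). i # l" and \<psi> = "\<lambda>l. (hd l, tl l)",
          OF enumerates_mult[OF enumerates_entry[of x] Cons.IH]])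
      (auto simp: is_index_def length_Suc_conv)
qed

lemma enumerates_admissible:
  assumes "a \<noteq> []"
  shows "enumerates (\<lambda>k. admissible k \<and> length k = length a) sum_list (\<lambda>k. 1 / power_prod a k)
     (prod_list (map entry_fps (butlast a)) * top_fps (last a))"
  using assms
proof (induction a rule: list_nonempty_induct)
  case (single x)
  have "enumerates (\<lambda>k. admissible k \<and> length k = length [x]) sum_list (\<lambda>k. 1 / power_prod [x] k) (top_fps x)"
    by (rule enumerates_reindex[where \<phi> = "\<lambda>i. [i]" and \<psi> = hd, OF enumerates_top[of x]])
      (auto simp: admissible_def is_index_def length_Suc_conv)
  then show ?case by simp
next
  case (cons x a)
  have "enumerates (\<lambda>k. admissible k \<and> length k = length (x # a)) sum_list (\<lambda>k. 1 / power_prod (x # a) k)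
      (entry_fps x * (prod_list (map entry_fps (butlast a)) * top_fps (last a)))"
    by (rule enumerates_reindex[where \<phi> = "\<lambda>(i, l). i # l" and \<psi> = "\<lambda>l. (hd l, tl l)",
          OF enumerates_mult[OF enumerates_entry[of x] cons.IH]])
      (use cons.hyps in \<open>auto simp: admissible_def is_index_def length_Suc_conv\<close>)
  then show ?case using cons.hyps by (simp add: mult.assoc)
qed

text \<open>In the summation domain the last entry of \<open>b\<close> equals the peak
  \<open>last a\<close> and does not occur in the summand, hence \<open>butlast b\<close>.\<close>

definition row_fps :: "nat list \<Rightarrow> nat list \<Rightarrow> real fps" where
  "row_fps a b = prod_list (map entry_fps (butlast b)) * (prod_list (map entry_fps (butlast a)) * top_fps (last a))"

lemma enumerates_row:
  assumes "a \<noteq> []"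
  shows "enumerates (\<lambda>(l, k). is_index l \<and> length l = length (butlast b) \<and> admissible k \<and> length k = length a)
    (\<lambda>(l, k). sum_list k + sum_list l) (\<lambda>(l, k). 1 / (power_prod a k * power_prod b l)) (row_fps a b)"
proof -
  \<comment> \<open>\<open>power_prod b l\<close> reads only the first \<open>length l\<close>
    entries, so the forced last entry of \<open>b\<close> is ignored.\<close>
  have pp: "power_prod b l = power_prod (butlast b) l" if "length l = length (butlast b)" for l
    using that by (auto simp: power_prod_def nth_butlast intro!: prod.cong)
  show ?thesis
    unfolding row_fps_def
    by (rule enumerates_reindex[where \<phi> = id and \<psi> = id,
          OF enumerates_mult[OF enumerates_entries[of "butlast b"] enumerates_admissible[OF assms]]])
      (auto simp: pp)
qed

definition array_fps :: "nat list list \<Rightarrow> nat list list \<Rightarrow> real fps" where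
  "array_fps as bs = prod_list (map2 row_fps as bs)"

definition zeta_term :: "nat list list \<Rightarrow> nat list list \<Rightarrow> nat list list \<Rightarrow> nat list list \<Rightarrow> real" where
  "zeta_term ls ks as bs = (\<Prod>i<length ks. 1 / (power_prod (as ! i) (ks ! i) * power_prod (bs ! i) (ls ! i)))"

lemma zeta_term_Cons:
  "zeta_term (l # ls) (k # ks) (a # as) (b # bs) =
     1 / (power_prod a k * power_prod b l) * zeta_term ls ks as bs"
  unfolding zeta_term_def by (subst prod.lessThan_Suc_shift length_Cons)+ simp

definition index_array :: "nat list \<Rightarrow> nat list \<Rightarrow> nat list list \<times> nat list list \<Rightarrow> bool" where
  "index_array s r = (\<lambda>(ls, ks). length ls = length r \<and> length ks = length r \<and>
     (\<forall>i<length r. is_index (ls ! i) \<and> length (ls ! i) = s ! i \<and> admissible (ks ! i) \<and> length (ks ! i) = r ! i))"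

lemma index_array_Cons:
  "index_array (s0 # s) (r0 # r) (ls, ks) \<longleftrightarrow> (\<exists>l k ls' ks'. ls = l # ls' \<and> ks = k # ks' \<and>
     is_index l \<and> length l = s0 \<and> admissible k \<and> length k = r0 \<and> index_array s r (ls', ks'))"
  by (cases ls; cases ks) (auto simp: index_array_def All_less_Suc2)

text \<open>For fixed summation variables all exponents of a given total weight are summed at once;
  weights add over the rows, so the row series multiply.\<close>

lemma enumerates_array:
  assumes "length as = length r" "length bs = length r" "length s = length r"
    and "\<And>i. i < length r \<Longrightarrow> length (as ! i) = r ! i \<and> length (bs ! i) = Suc (s ! i) \<and> 0 < r ! i"
  shows "enumerates (index_array s r)
    (\<lambda>(ls, ks). (\<Sum>i<length r. sum_list (ks ! i)) + (\<Sum>i<length r. sum_list (ls ! i)))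
    (\<lambda>(ls, ks). zeta_term ls ks as bs) (array_fps as bs)"
  using assms
proof (induction r arbitrary: as bs s)
  case Nil
  have "enumerates (index_array s [])
    (\<lambda>(ls, ks). (\<Sum>i<length []. sum_list (ks ! i)) + (\<Sum>i<length []. sum_list (ls ! i)))
    (\<lambda>(ls, ks). zeta_term ls ks as bs) 1"
    by (rule enumerates_singleton[of _ "([], [])"]) (auto simp: index_array_def zeta_term_def)
  then show ?case using Nil by (simp add: array_fps_def case_prod_unfold)
next
  case (Cons r0 r)
  obtain a as' b bs' s0 s' where eq: "as = a # as'" "bs = b # bs'" "s = s0 # s'"
    using Cons.prems by (metis length_Suc_conv)
  have a: "a \<noteq> []" "length a = r0" "length (butlast b) = s0"
    using Cons.prems(4)[of 0] by (auto simp: eq)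
  have IH: "enumerates (index_array s' r)
    (\<lambda>(ls, ks). (\<Sum>i<length r. sum_list (ks ! i)) + (\<Sum>i<length r. sum_list (ls ! i)))
    (\<lambda>(ls, ks). zeta_term ls ks as' bs') (array_fps as' bs')"
    using Cons.prems(1-3) Cons.prems(4)[of "Suc _"] by (intro Cons.IH) (auto simp: eq)
  have "enumerates (index_array s (r0 # r))
    (\<lambda>(ls, ks). (\<Sum>i<length (r0 # r). sum_list (ks ! i)) + (\<Sum>i<length (r0 # r). sum_list (ls ! i)))
    (\<lambda>(ls, ks). zeta_term ls ks as bs) (row_fps a b * array_fps as' bs')"
  proof (rule enumerates_reindex[where \<phi> = "\<lambda>((l, k), (ls, ks)). (l # ls, k # ks)" and
        \<psi> = "\<lambda>(ls, ks). ((hd ls, hd ks), (tl ls, tl ks))",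
        OF enumerates_mult[OF enumerates_row[OF a(1), of b] IH]], goal_cases)
    case (1 x)
    obtain l k ls ks where "x = ((l, k), (ls, ks))" by (metis surj_pair)
    with 1 a show ?case by (simp add: eq index_array_Cons)
  next
    case (2 y)
    then obtain l k ls ks where y: "y = (l # ls, k # ks)" and
      "is_index l" "length l = s0" "admissible k" "length k = r0" "index_array s' r (ls, ks)"
      by (cases y) (auto simp: eq index_array_Cons)
    with a show ?case
      by (simp add: eq zeta_term_Cons sum.lessThan_Suc_shift del: sum.lessThan_Suc)
  qed
  moreover have "array_fps as bs = row_fps a b * array_fps as' bs'"
    by (simp add: array_fps_def eq)
  ultimately show ?case by (simp only:)
qed

section \<open>Truncated summation domains\<close>

definition row_entries :: "nat \<Rightarrow> nat \<Rightarrow> nat \<Rightarrow> (nat list \<times> nat list) set" where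
  "row_entries N s r = {(a, b). length a = r \<and> length b = Suc s \<and> set a \<subseteq> {1..N} \<and> set b \<subseteq> {1..N} \<and>
     sorted_wrt (<) a \<and> sorted_wrt (\<le>) b \<and> last b = last a}"

definition descents :: "nat \<Rightarrow> nat \<Rightarrow> nat \<Rightarrow> nat list set" where
  "descents N p M = {a. length a = Suc p \<and> set a \<subseteq> {1..N} \<and> sorted_wrt (<) a \<and> last a = M}"

definition ascents :: "nat \<Rightarrow> nat \<Rightarrow> nat \<Rightarrow> nat list set" where
  "ascents N s m = {b. length b = Suc s \<and> set b \<subseteq> {1..N} \<and> sorted_wrt (\<le>) b \<and> hd b = m}"

lemma finite_lists_bounded: "finite {a :: nat list. set a \<subseteq> {1..N} \<and> length a = n}"
  by (rule finite_lists_length_eq) simp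

lemma finite_descents [simp]: "finite (descents N p M)"
  by (rule finite_subset[OF _ finite_lists_bounded[of N "Suc p"]]) (auto simp: descents_def)

lemma finite_ascents [simp]: "finite (ascents N s m)"
  by (rule finite_subset[OF _ finite_lists_bounded[of N "Suc s"]]) (auto simp: ascents_def)

lemma finite_row_entries [simp]: "finite (row_entries N s r)"
  by (rule finite_subset[OF _ finite_cartesian_product[OF finite_lists_bounded[of N r] finite_lists_bounded[of N "Suc s"]]])
    (auto simp: row_entries_def)

lemma sorted_wrt_Cons_hd:
  fixes x :: nat
  assumes "xs \<noteq> []"
  shows "sorted_wrt (<) (x # xs) \<longleftrightarrow> x < hd xs \<and> sorted_wrt (<) xs"
    and "sorted_wrt (\<le>) (x # xs) \<longleftrightarrow> x \<le> hd xs \<and> sorted_wrt (\<le>) xs"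
  using assms by (cases xs; force)+

text \<open>The smallest entry stands first in \<open>a\<close>; removing it replaces
  \<open>f\<close> by \<open>descend N e f\<close>, so the new step is the innermost one.\<close>

lemma sum_descents:
  assumes "M \<in> {1..N}"
  shows "(\<Sum>a\<in>descents N p M. prod_list (map e (butlast a)) * f (hd a)) = (descend N e ^^ p) f M"
proof (induction p arbitrary: f)
  case 0
  have "descents N 0 M = {[M]}" using assms by (auto simp: descents_def length_Suc_conv)
  then show ?case by simp
next
  case (Suc p)
  have "(\<Sum>a\<in>descents N (Suc p) M. prod_list (map e (butlast a)) * f (hd a)) =
      (\<Sum>(a, x)\<in>Sigma (descents N p M) (\<lambda>a. {x. x \<in> {1..N} \<and> x < hd a}).
        prod_list (map e (butlast a)) * (e x * f x))"
  proof (rule sum.reindex_bij_witness[of _ "\<lambda>(a, x). x # a" "\<lambda>a. (tl a, hd a)"], goal_cases)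
    case (2 a)
    then obtain x y a' where "a = x # y # a'" by (auto simp: descents_def length_Suc_conv)
    with 2 show ?case by (auto simp: descents_def)
  next
    case (4 ax)
    then obtain a x where ax: "ax = (a, x)" "a \<in> descents N p M" "x \<in> {1..N}" "x < hd a" by auto
    then have "a \<noteq> []" by (auto simp: descents_def)
    with ax show ?case by (auto simp: descents_def sorted_wrt_Cons_hd simp del: sorted_wrt.simps)
  next
    case (5 a)
    then obtain x y a' where "a = x # y # a'" by (auto simp: descents_def length_Suc_conv)
    then show ?case by (simp add: mult_ac)
  qed (auto simp: descents_def length_Suc_conv)
  also have "\<dots> = (\<Sum>a\<in>descents N p M. \<Sum>x | x \<in> {1..N} \<and> x < hd a. prod_list (map e (butlast a)) * (e x * f x))"
    by (rule sum.Sigma[symmetric]) auto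
  also have "\<dots> = (\<Sum>a\<in>descents N p M. prod_list (map e (butlast a)) * descend N e f (hd a))"
    by (simp add: descend_def below_def sum_distrib_left)
  also have "\<dots> = (descend N e ^^ Suc p) f M"
    by (simp only: Suc funpow_Suc_right comp_apply)
  finally show ?case .
qed

lemma sum_ascents:
  assumes "m \<in> {1..N}"
  shows "(\<Sum>b\<in>ascents N s m. prod_list (map e (butlast b)) * g (last b)) = (ascend N e ^^ s) g m"
  using assms
proof (induction s arbitrary: m)
  case 0
  then have "ascents N 0 m = {[m]}" by (auto simp: ascents_def length_Suc_conv)
  then show ?case by simp
next
  case (Suc s)
  have "(\<Sum>b\<in>ascents N (Suc s) m. prod_list (map e (butlast b)) * g (last b)) =
      (\<Sum>(x, b)\<in>Sigma {x. x \<in> {1..N} \<and> m \<le> x} (ascents N s).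
        e m * (prod_list (map e (butlast b)) * g (last b)))"
  proof (rule sum.reindex_bij_witness[of _ "\<lambda>(x, b). m # b" "\<lambda>b. (hd (tl b), tl b)"], goal_cases)
    case (2 b)
    then obtain x y b' where "b = x # y # b'" by (auto simp: ascents_def length_Suc_conv)
    with 2 show ?case by (auto simp: ascents_def)
  next
    case (4 xb)
    then obtain x b where xb: "xb = (x, b)" "b \<in> ascents N s x" "x \<in> {1..N}" "m \<le> x" by auto
    then have "b \<noteq> []" by (auto simp: ascents_def)
    with xb Suc.prems show ?case by (auto simp: ascents_def sorted_wrt_Cons_hd simp del: sorted_wrt.simps)
  next
    case (5 b)
    then obtain y b' where "b = m # y # b'" by (auto simp: ascents_def length_Suc_conv)
    then show ?case by (simp add: mult_ac)
  qed (auto simp: ascents_def length_Suc_conv)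
  also have "\<dots> = (\<Sum>x | x \<in> {1..N} \<and> m \<le> x. \<Sum>b\<in>ascents N s x. e m * (prod_list (map e (butlast b)) * g (last b)))"
    by (rule sum.Sigma[symmetric]) auto
  also have "\<dots> = (\<Sum>x | x \<in> {1..N} \<and> m \<le> x. e m * (ascend N e ^^ s) g x)"
    by (intro sum.cong refl) (use Suc.IH in \<open>auto simp: sum_distrib_left[symmetric]\<close>)
  also have "\<dots> = (ascend N e ^^ Suc s) g m"
    by (simp add: ascend_def above_def sum_distrib_left)
  finally show ?case .
qed

text \<open>Rows are summed in the order of the zigzag: first entry of \<open>b\<close>, then the
  ascent, then the descents whose last entry is the peak \<open>last b\<close>.\<close>

lemma sum_row_entries:
  "(\<Sum>(a, b) | (a, b) \<in> row_entries N s (Suc p) \<and> hd b < c. row_fps a b * f (hd a)) =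
     below N (row_weight N entry_fps top_fps s p f) c"
proof -
  define w where "w a b = prod_list (map entry_fps (butlast b)) * (top_fps (last b) *
      (prod_list (map entry_fps (butlast a)) * f (hd a)))" for a b
  have "(\<Sum>(a, b) | (a, b) \<in> row_entries N s (Suc p) \<and> hd b < c. row_fps a b * f (hd a)) =
      (\<Sum>(m, b, a)\<in>Sigma {m. m \<in> {1..N} \<and> m < c} (\<lambda>m. Sigma (ascents N s m) (\<lambda>b. descents N p (last b))). w a b)"
    by (rule sum.reindex_bij_witness[of _ "\<lambda>(m, b, a). (a, b)" "\<lambda>(a, b). (hd b, b, a)"])
      (auto simp: row_entries_def ascents_def descents_def row_fps_def w_def mult_ac length_Suc_conv)
  also have "\<dots> = (\<Sum>m | m \<in> {1..N} \<and> m < c. \<Sum>(b, a)\<in>Sigma (ascents N s m) (\<lambda>b. descents N p (last b)). w a b)"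
    by (subst sum.Sigma) auto
  also have "\<dots> = (\<Sum>m | m \<in> {1..N} \<and> m < c. \<Sum>b\<in>ascents N s m. \<Sum>a\<in>descents N p (last b). w a b)"
    by (intro sum.cong refl, subst sum.Sigma) auto
  also have "\<dots> = (\<Sum>m | m \<in> {1..N} \<and> m < c. \<Sum>b\<in>ascents N s m. prod_list (map entry_fps (butlast b)) *
      (top_fps (last b) * (descend N entry_fps ^^ p) f (last b)))"
  proof (intro sum.cong refl)
    fix m b assume "b \<in> ascents N s m"
    then have "set b \<subseteq> {1..N}" "b \<noteq> []" by (auto simp: ascents_def)
    then have "last b \<in> {1..N}" using last_in_set by blast
    then show "(\<Sum>a\<in>descents N p (last b). w a b) = prod_list (map entry_fps (butlast b)) *
        (top_fps (last b) * (descend N entry_fps ^^ p) f (last b))"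
      unfolding w_def sum_distrib_left[symmetric] by (simp only: sum_descents)
  qed
  also have "\<dots> = below N (row_weight N entry_fps top_fps s p f) c"
    unfolding below_def row_weight_def
    by (intro sum.cong refl sum_ascents) auto
  finally show ?thesis .
qed

text \<open>Truncation at \<open>N\<close> of the domain of \<open>zeta2\<close>, with an extra
  strict bound \<open>c\<close> on the first variable; in the recursion \<open>c\<close> is the
  smallest \<open>a\<close> of the preceding row.\<close>

definition array_entries :: "nat \<Rightarrow> nat list \<Rightarrow> nat list \<Rightarrow> nat \<Rightarrow> (nat list list \<times> nat list list) set" where
  "array_entries N s r c = {(as, bs). length as = length r \<and> length bs = length r \<and>
     (\<forall>i<length r. (as ! i, bs ! i) \<in> row_entries N (s ! i) (r ! i)) \<and>
     (\<forall>i. i + 1 < length r \<longrightarrow> hd (bs ! (i + 1)) < hd (as ! i)) \<and> (r \<noteq> [] \<longrightarrow> hd (bs ! 0) < c)}"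

lemma array_entries_Cons:
  "(as, bs) \<in> array_entries N (s0 # s) (r0 # r) c \<longleftrightarrow> (\<exists>a b as' bs'. as = a # as' \<and> bs = b # bs' \<and>
     (a, b) \<in> row_entries N s0 r0 \<and> hd b < c \<and> (as', bs') \<in> array_entries N s r (hd a))"
proof (cases "\<exists>a b as' bs'. as = a # as' \<and> bs = b # bs'")
  case True
  then obtain a b as' bs' where eq: "as = a # as'" "bs = b # bs'" by blast
  have "(\<forall>i. i + 1 < length (r0 # r) \<longrightarrow> hd ((b # bs') ! (i + 1)) < hd ((a # as') ! i)) \<longleftrightarrow>
      (r \<noteq> [] \<longrightarrow> hd (bs' ! 0) < hd a) \<and> (\<forall>i. i + 1 < length r \<longrightarrow> hd (bs' ! (i + 1)) < hd (as' ! i))"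
    (is "?L \<longleftrightarrow> ?R")
  proof
    assume L: ?L
    from L[rule_format, of 0] L[rule_format, of "Suc _"] show ?R by auto
  next
    assume R: ?R
    show ?L
    proof (intro allI impI)
      fix i assume "i + 1 < length (r0 # r)"
      with R show "hd ((b # bs') ! (i + 1)) < hd ((a # as') ! i)" by (cases i) auto
    qed
  qed
  then show ?thesis
    by (simp only: eq array_entries_def mem_Collect_eq prod.case) (auto simp: All_less_Suc2)
next
  case False
  then show ?thesis by (cases as; cases bs) (auto simp: array_entries_def)
qed

lemma finite_array_entries:
  assumes "length s = length r"
  shows "finite (array_entries N s r c)"
  using assms
proof (induction s r arbitrary: c rule: list_induct2)
  case Nil
  have "array_entries N [] [] c \<subseteq> {([], [])}" by (auto simp: array_entries_def)
  then show ?case by (rule finite_subset) simp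
next
  case (Cons s0 s r0 r)
  have "array_entries N (s0 # s) (r0 # r) c \<subseteq> (\<lambda>((a, b), (as, bs)). (a # as, b # bs)) `
      Sigma (row_entries N s0 r0) (\<lambda>(a, b). array_entries N s r (hd a))"
    by (force simp: array_entries_Cons)
  then show ?case
    by (rule finite_subset) (intro finite_imageI finite_SigmaI; use Cons.IH in \<open>simp add: case_prod_unfold\<close>)
qed

text \<open>Splitting off the first row leaves the same sum with bound \<open>hd a\<close>, which
  matches the recursion of \<open>ribbon\<close>; \<open>r - 1\<close> counts the entries of a
  descent below its peak.\<close>

lemma sum_array_entries:
  assumes "length s = length r" "\<forall>x\<in>set r. 0 < x"
  shows "(\<Sum>(as, bs)\<in>array_entries N s r c. array_fps as bs) =
    ribbon N entry_fps top_fps (map2 (\<lambda>s r. (s, r - 1)) s r) c"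
  using assms
proof (induction s r arbitrary: c rule: list_induct2)
  case Nil
  have "array_entries N [] [] c = {([], [])}" by (auto simp: array_entries_def)
  then show ?case by (simp add: array_fps_def)
next
  case (Cons s0 s r0 r)
  then obtain p where p: "r0 = Suc p" by (auto dest: gr0_implies_Suc)
  define R where "R = ribbon N entry_fps top_fps (map2 (\<lambda>s r. (s, r - 1)) s r)"
  define X where "X = {(a, b). (a, b) \<in> row_entries N s0 r0 \<and> hd b < c}"
  have IH: "R c' = (\<Sum>(as, bs)\<in>array_entries N s r c'. array_fps as bs)" for c'
    using Cons by (simp add: R_def)
  have finX: "finite X" by (rule finite_subset[of _ "row_entries N s0 r0"]) (auto simp: X_def)
  have "(\<Sum>(as, bs)\<in>array_entries N (s0 # s) (r0 # r) c. array_fps as bs) =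
      (\<Sum>((a, b), (as, bs))\<in>Sigma X (\<lambda>(a, b). array_entries N s r (hd a)). row_fps a b * array_fps as bs)"
    by (rule sum.reindex_bij_witness[of _ "\<lambda>((a, b), (as, bs)). (a # as, b # bs)"
          "\<lambda>(as, bs). ((hd as, hd bs), (tl as, tl bs))"])
      (auto simp: array_entries_Cons X_def array_fps_def)
  also have "\<dots> = (\<Sum>x\<in>X. \<Sum>(as, bs)\<in>array_entries N s r (hd (fst x)). row_fps (fst x) (snd x) * array_fps as bs)"
    by (subst sum.Sigma) (auto simp: finX finite_array_entries Cons.hyps case_prod_unfold)
  also have "\<dots> = (\<Sum>(a, b)\<in>X. row_fps a b * R (hd a))"
    by (simp add: IH sum_distrib_left case_prod_unfold)
  also have "\<dots> = below N (row_weight N entry_fps top_fps s0 p R) c"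
    unfolding X_def p by (rule sum_row_entries)
  finally show ?case by (simp add: R_def p)
qed

text \<open>All variables are at most \<open>N\<close>, so the bound \<open>Suc N\<close> imposes
  nothing.\<close>

lemma array_entries_eq_zeta_domain:
  assumes "index_array s r (ls, ks)" "length s = length r" "\<forall>x\<in>set r. 0 < x"
  shows "array_entries N s r (Suc N) = {(as, bs) \<in> zeta_domain ls ks.
    (\<forall>a\<in>set as. set a \<subseteq> {..N}) \<and> (\<forall>b\<in>set bs. set b \<subseteq> {..N})}"
proof -
  have len: "length ks = length r" "\<And>i. i < length r \<Longrightarrow> length (ks ! i) = r ! i \<and> length (ls ! i) = s ! i"
    using assms(1) by (auto simp: index_array_def)
  have row: "(a, b) \<in> row_entries N (s ! i) (r ! i) \<longleftrightarrow>
      (length a = length (ks ! i) \<and> length b = length (ls ! i) + 1 \<and> (\<forall>x\<in>set a. 0 < x) \<and> (\<forall>x\<in>set b. 0 < x) \<and>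
      sorted_wrt (<) a \<and> sorted_wrt (\<le>) b \<and> last b = last a) \<and> set a \<subseteq> {..N} \<and> set b \<subseteq> {..N}"
    if "i < length r" for a b i
    using len(2)[OF that] by (auto simp: row_entries_def Suc_le_eq subset_iff)
  have hd_b: "hd (bs ! 0) < Suc N" if "r \<noteq> []" "(as ! 0, bs ! 0) \<in> row_entries N (s ! 0) (r ! 0)" for as bs
    using that(2) by (auto simp: row_entries_def length_Suc_conv)
  show ?thesis
  proof (intro set_eqI, clarify)
    fix as bs
    show "(as, bs) \<in> array_entries N s r (Suc N) \<longleftrightarrow> (as, bs) \<in> {(as, bs) \<in> zeta_domain ls ks.
        (\<forall>a\<in>set as. set a \<subseteq> {..N}) \<and> (\<forall>b\<in>set bs. set b \<subseteq> {..N})}"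
    proof (cases "length as = length r \<and> length bs = length r")
      case True
      have "(\<forall>i<length r. (as ! i, bs ! i) \<in> row_entries N (s ! i) (r ! i)) \<longleftrightarrow>
        (\<forall>i<length r. length (as ! i) = length (ks ! i) \<and> length (bs ! i) = length (ls ! i) + 1 \<and>
          (\<forall>x\<in>set (as ! i). 0 < x) \<and> (\<forall>x\<in>set (bs ! i). 0 < x) \<and>
          sorted_wrt (<) (as ! i) \<and> sorted_wrt (\<le>) (bs ! i) \<and> last (bs ! i) = last (as ! i)) \<and>
        (\<forall>a\<in>set as. set a \<subseteq> {..N}) \<and> (\<forall>b\<in>set bs. set b \<subseteq> {..N})"
        (is "?lhs \<longleftrightarrow> (\<forall>i<length r. ?A i) \<and> _ \<and> _")
      proof -
        have "?lhs \<longleftrightarrow> (\<forall>i<length r. ?A i \<and> set (as ! i) \<subseteq> {..N} \<and> set (bs ! i) \<subseteq> {..N})"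
          using row by (intro all_cong) metis
        moreover have "(\<forall>a\<in>set as. set a \<subseteq> {..N}) \<longleftrightarrow> (\<forall>i<length r. set (as ! i) \<subseteq> {..N})"
          "(\<forall>b\<in>set bs. set b \<subseteq> {..N}) \<longleftrightarrow> (\<forall>i<length r. set (bs ! i) \<subseteq> {..N})"
          unfolding all_set_conv_all_nth using True by auto
        ultimately show ?thesis by (simp only: all_conj_distrib imp_conjR)
      qed
      moreover have "(r \<noteq> [] \<longrightarrow> hd (bs ! 0) < Suc N)" if "\<forall>i<length r. (as ! i, bs ! i) \<in> row_entries N (s ! i) (r ! i)"
        using hd_b[of as bs] that by auto
      ultimately show ?thesis
        using True unfolding array_entries_def zeta_domain_def mem_Collect_eq prod.case len(1) by argo
    next
      case False
      then show ?thesis by (auto simp: array_entries_def zeta_domain_def len(1))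
    qed
  qed
qed

section \<open>Exchange of summations and passage to the limit\<close>

lemma zeta_term_nonneg: "0 \<le> zeta_term ls ks as bs"
  unfolding zeta_term_def power_prod_def by (intro prod_nonneg) (auto intro!: mult_nonneg_nonneg prod_nonneg)

text \<open>At each point of the truncated domain the coefficient of x^w is a sum over index arrays;
  both sums are finite and can be exchanged.\<close>

lemma ribbon_nth_eq_sum:
  assumes "length s = length r" "\<forall>x\<in>set r. 0 < x"
  shows "ribbon N entry_fps top_fps (map2 (\<lambda>s r. (s, r - 1)) s r) (Suc N) $ w =
    (\<Sum>(ls, ks)\<in>index_arrays w s r. \<Sum>(as, bs)\<in>array_entries N s r (Suc N). zeta_term ls ks as bs)"
proof -
  have ia: "index_arrays w s r = {x. index_array s r x \<and>
      (case x of (ls, ks) \<Rightarrow> (\<Sum>i<length r. sum_list (ks ! i)) + (\<Sum>i<length r. sum_list (ls ! i))) = w}"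
    by (auto simp: index_arrays_def index_array_def)
  have "ribbon N entry_fps top_fps (map2 (\<lambda>s r. (s, r - 1)) s r) (Suc N) $ w =
      (\<Sum>x\<in>array_entries N s r (Suc N). array_fps (fst x) (snd x) $ w)"
    unfolding sum_array_entries[OF assms, symmetric] by (simp add: fps_sum_nth case_prod_unfold)
  also have "\<dots> = (\<Sum>x\<in>array_entries N s r (Suc N). \<Sum>(ls, ks)\<in>index_arrays w s r. zeta_term ls ks (fst x) (snd x))"
  proof (intro sum.cong refl)
    fix x assume "x \<in> array_entries N s r (Suc N)"
    then have "enumerates (index_array s r)
      (\<lambda>(ls, ks). (\<Sum>i<length r. sum_list (ks ! i)) + (\<Sum>i<length r. sum_list (ls ! i)))
      (\<lambda>(ls, ks). zeta_term ls ks (fst x) (snd x)) (array_fps (fst x) (snd x))"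
      using assms by (intro enumerates_array) (auto simp: array_entries_def row_entries_def)
    then show "array_fps (fst x) (snd x) $ w = (\<Sum>(ls, ks)\<in>index_arrays w s r. zeta_term ls ks (fst x) (snd x))"
      unfolding ia enumerates_def by blast
  qed
  also have "\<dots> = (\<Sum>(ls, ks)\<in>index_arrays w s r. \<Sum>(as, bs)\<in>array_entries N s r (Suc N). zeta_term ls ks as bs)"
    unfolding case_prod_unfold by (rule sum.swap)
  finally show ?thesis .
qed

text \<open>Convergence of the total bounds each of its nonnegative summands, which increase with
  \<open>N\<close>; hence every truncated \<open>zeta2\<close> converges, and its limit is the
  infinite sum.\<close>

lemma S_sum_tendsto:
  assumes "length s = length r" "\<forall>x\<in>set r. 0 < x"
    and conv: "(\<lambda>N. ribbon N entry_fps top_fps (map2 (\<lambda>s r. (s, r - 1)) s r) (Suc N) $ w) \<longlonglongrightarrow> v"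
  shows "S_sum w s r = v"
proof -
  define X where "X N = array_entries N s r (Suc N)" for N
  define Z where "Z x N = (\<Sum>(as, bs)\<in>X N. zeta_term (fst x) (snd x) as bs)" for x N
  define R where "R N = ribbon N entry_fps top_fps (map2 (\<lambda>s r. (s, r - 1)) s r) (Suc N) $ w" for N
  have R: "R N = (\<Sum>x\<in>index_arrays w s r. Z x N)" for N
    unfolding R_def Z_def X_def ribbon_nth_eq_sum[OF assms(1,2)] by (simp add: case_prod_unfold)
  have Z_nonneg: "0 \<le> Z x N" for x N
    unfolding Z_def by (intro sum_nonneg) (auto simp: zeta_term_nonneg)
  obtain C where C: "\<And>N. \<bar>R N\<bar> \<le> C"
    using convergent_imp_Bseq[OF convergentI[OF conv[folded R_def]]] by (auto simp: Bseq_def)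
  have lim: "Z x \<longlonglongrightarrow> zeta2 (fst x) (snd x)" if x: "x \<in> index_arrays w s r" for x
  proof -
    obtain ls ks where x_eq: "x = (ls, ks)" by force
    have idx: "index_array s r (ls, ks)"
      using x by (auto simp: x_eq index_arrays_def index_array_def)
    have X: "X N = {(as, bs) \<in> zeta_domain ls ks.
        (\<forall>a\<in>set as. set a \<subseteq> {..N}) \<and> (\<forall>b\<in>set bs. set b \<subseteq> {..N})}" for N
      unfolding X_def by (rule array_entries_eq_zeta_domain[OF idx assms(1,2)])
    have fin: "finite (X N)" for N unfolding X_def by (rule finite_array_entries[OF assms(1)])
    have mono: "mono X"
      unfolding mono_def X by (fastforce simp: subset_iff)
    have inc: "incseq (Z x)"
      unfolding incseq_def Z_def
      using mono fin by (auto intro!: sum_mono2 simp: zeta_term_nonneg dest: monoD)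
    have "Z x N \<le> C" for N
    proof -
      have "Z x N \<le> R N"
        unfolding R by (rule member_le_sum[OF x Z_nonneg finite_index_arrays])
      then show ?thesis using C[of N] by linarith
    qed
    then obtain L where L: "Z x \<longlonglongrightarrow> L"
      using incseq_convergent[OF inc, of C] by blast
    have "infsum (\<lambda>(as, bs). zeta_term ls ks as bs) (zeta_domain ls ks) = L"
    proof (rule infsum_eq_lim_exhaustion[where X = X])
      show "zeta_domain ls ks \<subseteq> (\<Union>N. X N)"
      proof
        fix z assume z: "z \<in> zeta_domain ls ks"
        obtain as bs where z_eq: "z = (as, bs)" by force
        define N where "N = sum_list (concat as) + sum_list (concat bs)"
        have "y \<le> N" if "c \<in> set as \<union> set bs" "y \<in> set c" for c y
        proof -
          have "y \<in> set (concat as @ concat bs)" using that by auto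
          then have "y \<le> sum_list (concat as @ concat bs)" by (intro member_le_sum_list) simp_all
          then show ?thesis by (simp add: N_def)
        qed
        then have "z \<in> X N" using z by (auto simp: X z_eq)
        then show "z \<in> (\<Union>N. X N)" by blast
      qed
      show "(\<lambda>N. sum (\<lambda>(as, bs). zeta_term ls ks as bs) (X N)) \<longlonglongrightarrow> L"
        using L by (simp add: Z_def[abs_def] x_eq)
    qed (use fin mono in \<open>auto simp: X zeta_term_nonneg\<close>)
    moreover have "zeta2 ls ks = infsum (\<lambda>(as, bs). zeta_term ls ks as bs) (zeta_domain ls ks)"
      unfolding zeta2_def zeta_term_def power_prod_def ..
    ultimately show ?thesis using L by (simp add: x_eq)
  qed
  have "R \<longlonglongrightarrow> (\<Sum>x\<in>index_arrays w s r. zeta2 (fst x) (snd x))"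
    unfolding R[abs_def] by (intro tendsto_sum lim)
  then show ?thesis
    using LIMSEQ_unique[OF conv[folded R_def]] by (simp add: S_sum_def case_prod_unfold)
qed

theorem corollary3p5:
  fixes n w :: nat and s r :: "nat list"
  assumes "n \<ge> 1"
    and "length s = n" and "length r = n"
    and "\<forall>i<n. r ! i > 0"
  shows "\<exists>(K :: nat list set) (c :: nat list \<Rightarrow> rat).
    finite K \<and>
    (\<forall>k\<in>K. admissible k \<and> weight k = w \<and> depth k \<le> n) \<and>
    S_sum w s r = (\<Sum>k\<in>K. of_rat (c k) * mzv k)"
proof -
  have r: "\<forall>x\<in>set r. 0 < x" using assms(3,4) by (auto simp: in_set_conv_nth)
  have "map2 (\<lambda>s r. (s, r - 1)) s r \<noteq> []" "length (map2 (\<lambda>s r. (s, r - 1)) s r) = n"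
    using assms(1-3) by auto
  from ribbon_in_lim_span[OF this(1), of w] this(2) obtain v where v: "v \<in> mzv_span n w"
    "(\<lambda>N. ribbon N entry_fps top_fps (map2 (\<lambda>s r. (s, r - 1)) s r) (Suc N) $ w) \<longlonglongrightarrow> v"
    by (auto simp: lim_span_def)
  have "S_sum w s r = v"
    using S_sum_tendsto[OF _ r v(2)] assms(2,3) by simp
  with v(1) obtain c :: "nat list \<Rightarrow> rat" where
    "S_sum w s r = (\<Sum>k\<in>big_indices n w. of_rat (c k) * mzv k)"
    by (auto simp: mzv_span_def)
  moreover have "admissible k \<and> sum_list k = w \<and> length k \<le> n" if "k \<in> big_indices n w" for k
    using that by (fastforce simp: big_indices_def admissible_def is_index_def)
  ultimately show ?thesis
    by (intro exI[of _ "big_indices n w"] exI[of _ c]) simp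
qed

end
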